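(* For every finite monoid presentation $\langle \mathscr{A} \mid \mathscr{R} \rangle$ which is weakly $C(4)$, there exists a two-tape Turing machine which solves the corresponding word problem (given $u, v \in \mathscr{A}^*$, decide whether $u \equiv v$) in time linear in the lengths of the input words.
   Context: A finite monoid presentation $\langle \mathscr{A} \mid \mathscr{R} \rangle$ consists of a finite alphabet $\mathscr{A}$ and a finite set $\mathscr{R} \subseteq \mathscr{A}^* \times \mathscr{A}^*$ of relations. For $u,v\in\mathscr{A}^*$, $u \equiv v$ means that $u$ and $v$ represent the same element of the monoid presented. A relation word is a word which occurs as one side of a relation in the presentation. A piece is a word which occurs as a factor of two distinct relation words, or in two different (possibly overlapping) places within one relation word; by convention the empty word is always a piece. (So pieces are determined by the set of relation words: the same word occurring as a side of several relations does not thereby become a piece.) The presentation is weakly $C(n)$, for a positive integer $n$, if no relation word can be written as a product of strictly fewer than $n$ pieces. The presentation is fixed, i.e. it is not part of the input, and the constants in the running time may depend on it. *)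

theory Defs
  imports Main "HOL-Library.Sublist"
begin

section \<open>Finite monoid presentations\<close>

definition finite_presentation :: "'a set \<Rightarrow> ('a list \<times> 'a list) set \<Rightarrow> bool" where
  "finite_presentation A R \<longleftrightarrow> finite A \<and> finite R \<and> R \<subseteq> lists A \<times> lists A"

text \<open>The congruence on the free monoid \<^term>\<open>lists A\<close> generated by \<open>R\<close>; the monoid presented
  is its quotient, so two words represent the same element iff they are congruent.\<close>

inductive same_element ::
  "'a set \<Rightarrow> ('a list \<times> 'a list) set \<Rightarrow> 'a list \<Rightarrow> 'a list \<Rightarrow> bool" for A R where
  rel: "(u, v) \<in> R \<Longrightarrow> same_element A R u v"
| refl: "u \<in> lists A \<Longrightarrow> same_element A R u u"
| sym: "same_element A R u v \<Longrightarrow> same_element A R v u"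
| trans: "same_element A R u v \<Longrightarrow> same_element A R v w \<Longrightarrow> same_element A R u w"
| mult: "same_element A R u u' \<Longrightarrow> same_element A R v v' \<Longrightarrow> same_element A R (u @ v) (u' @ v')"


section \<open>Small overlap conditions\<close>

definition relation_words :: "('a list \<times> 'a list) set \<Rightarrow> 'a list set" where
  "relation_words R = fst ` R \<union> snd ` R"

text \<open>In the last disjunct \<open>x\<close> and \<open>x'\<close> are the prefixes preceding the two occurrences of \<open>p\<close>
  in \<open>r\<close>, so \<open>x \<noteq> x'\<close> says that the occurrences are at different, possibly overlapping, places.\<close>

definition piece :: "('a list \<times> 'a list) set \<Rightarrow> 'a list \<Rightarrow> bool" where
  "piece R p \<longleftrightarrow>
     p = [] \<or>
     (\<exists>r \<in> relation_words R. \<exists>s \<in> relation_words R. r \<noteq> s \<and> sublist p r \<and> sublist p s) \<or>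
     (\<exists>r \<in> relation_words R. \<exists>x y x' y'. r = x @ p @ y \<and> r = x' @ p @ y' \<and> x \<noteq> x')"

definition weakly_C :: "nat \<Rightarrow> ('a list \<times> 'a list) set \<Rightarrow> bool" where
  "weakly_C n R \<longleftrightarrow>
     (\<forall>r \<in> relation_words R.
        \<not> (\<exists>ps. length ps < n \<and> (\<forall>p \<in> set ps. piece R p) \<and> r = concat ps))"


section \<open>Deterministic two-tape Turing machines\<close>

datatype direction = Left | Stay | Right

record ('q, 's) tm2 =
  states :: "'q set"
  symbols :: "'s set"
  blank :: 's
  start :: 'q
  accept :: 'q
  reject :: 'q
  delta :: "'q \<Rightarrow> 's \<Rightarrow> 's \<Rightarrow> 'q \<times> ('s \<times> direction) \<times> ('s \<times> direction)"

text \<open>\<open>I\<close> is the input alphabet.\<close>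

definition wf_tm2 :: "'s set \<Rightarrow> ('q, 's) tm2 \<Rightarrow> bool" where
  "wf_tm2 I M \<longleftrightarrow>
     finite (states M) \<and> finite (symbols M) \<and>
     start M \<in> states M \<and> accept M \<in> states M \<and> reject M \<in> states M \<and>
     accept M \<noteq> reject M \<and>
     blank M \<in> symbols M \<and> I \<subseteq> symbols M - {blank M} \<and>
     (\<forall>q \<in> states M - {accept M, reject M}. \<forall>a \<in> symbols M. \<forall>b \<in> symbols M.
        delta M q a b \<in> states M \<times> (symbols M \<times> UNIV) \<times> (symbols M \<times> UNIV))"

text \<open>A tape is infinite in both directions; it is given by its contents and its head position.\<close>

type_synonym 's tape = "(int \<Rightarrow> 's) \<times> int"

type_synonym ('q, 's) config = "'q \<times> 's tape \<times> 's tape"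

fun read_tape :: "'s tape \<Rightarrow> 's" where
  "read_tape (f, h) = f h"

fun move_head :: "direction \<Rightarrow> int \<Rightarrow> int" where
  "move_head Left h = h - 1"
| "move_head Stay h = h"
| "move_head Right h = h + 1"

fun act_tape :: "'s \<times> direction \<Rightarrow> 's tape \<Rightarrow> 's tape" where
  "act_tape (a, d) (f, h) = (f(h := a), move_head d h)"

text \<open>Halting configurations are fixed points of \<open>step\<close>.\<close>

fun step :: "('q, 's) tm2 \<Rightarrow> ('q, 's) config \<Rightarrow> ('q, 's) config" where
  "step M (q, S, T) =
     (if q = accept M \<or> q = reject M then (q, S, T)
      else (case delta M q (read_tape S) (read_tape T) of
              (q', a, b) \<Rightarrow> (q', act_tape a S, act_tape b T)))"

definition tape_of :: "'s \<Rightarrow> 's list \<Rightarrow> 's tape" where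
  "tape_of b w = ((\<lambda>i. if 0 \<le> i \<and> i < int (length w) then w ! nat i else b), 0)"

text \<open>The input is written on the first tape, the second tape is blank.\<close>

definition initial_config :: "('q, 's) tm2 \<Rightarrow> 's list \<Rightarrow> ('q, 's) config" where
  "initial_config M w = (start M, tape_of (blank M) w, tape_of (blank M) [])"

definition state_after :: "('q, 's) tm2 \<Rightarrow> 's list \<Rightarrow> nat \<Rightarrow> 'q" where
  "state_after M w t = fst ((step M ^^ t) (initial_config M w))"


section \<open>Solving the word problem in linear time\<close>

text \<open>Besides the input symbols, there are infinitely many symbols \<open>Work i\<close> available, so that
  fixing this type puts no bound on the size of the tape alphabet of a machine.\<close>

datatype 'a tape_symbol = Letter 'a | Separator | Work nat

definition input_symbols :: "'a set \<Rightarrow> 'a tape_symbol set" where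
  "input_symbols A = insert Separator (Letter ` A)"

definition encode_pair :: "'a list \<Rightarrow> 'a list \<Rightarrow> 'a tape_symbol list" where
  "encode_pair u v = map Letter u @ [Separator] @ map Letter v"

text \<open>The summand \<open>1\<close> in the time bound only matters when both words are empty.\<close>

definition solves_word_problem_in_linear_time ::
  "('q, 'a tape_symbol) tm2 \<Rightarrow> 'a set \<Rightarrow> ('a list \<times> 'a list) set \<Rightarrow> bool" where
  "solves_word_problem_in_linear_time M A R \<longleftrightarrow>
     (\<exists>c. \<forall>u \<in> lists A. \<forall>v \<in> lists A. \<exists>t \<le> c * (length u + length v + 1).
        state_after M (encode_pair u v) t
          = (if same_element A R u v then accept M else reject M))"

end

(*
Write a relation word as r = stem r @ tail r, where tail r is its longest piece suffix. Under C(4) a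
word u is congruent to a word with a relation word as prefix only if u starts with a stem that no
other stem overlaps from inside ("clean"), which is visible in a bounded prefix of u.

If u has no clean stem as prefix, then no rewriting ever touches its first letter, and the first
letters of both words can be compared and removed. If u = stem r @ u' with a clean stem, then every
congruent v is stem r' @ v' with r' a complement of r (reachable from r by relations), and u and v
are congruent either because r' = r and u', v' are congruent, or through switches of r, which require
u' and v' to be congruent to words with prefixes tail r and tail r'. Since the piece by which a tail
can be rewritten together with what follows is unique by C(4), this second condition is again an
instance of one problem: given u, v and a piece z, are u and v congruent, and congruent to a word
with prefix z? (Compare Kambites, Small overlap monoids I.)

Each reduction replaces a consumed prefix of u or v by at most a piece, so the pieces and a bounded
look-ahead fit into a finite control while the rest of u and v is only read from left to right. The
Turing machine copies v to the second tape and then simulates this two-head one-way automaton.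
*)
theory Submission
  imports Defs
begin

section \<open>Pieces, stems and tails\<close>

lemma append_eq_split:
  assumes "xs @ ys = zs @ ts"
  shows "(\<exists>k. zs = xs @ k \<and> ys = k @ ts) \<or> (\<exists>k. xs = zs @ k \<and> ts = k @ ys)"
  using assms by (fastforce simp: append_eq_append_conv2)

locale weakly_C4 =
  fixes R :: "('a list \<times> 'a list) set"
  assumes finite_R: "finite R" and weakly_C4: "weakly_C 4 R"
begin

abbreviation "W \<equiv> relation_words R"

text \<open>The closure relates every word to itself, so \<open>r \<in> W\<close> keeps words
  outside \<open>W\<close> from being their own complements.\<close>

definition complement :: "'a list \<Rightarrow> 'a list \<Rightarrow> bool" where
  "complement r s \<longleftrightarrow> r \<in> W \<and> (r, s) \<in> (R \<union> R\<inverse>)\<^sup>*"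

lemma complement_W: "complement r s \<Longrightarrow> r \<in> W" "complement r s \<Longrightarrow> s \<in> W"
proof -
  assume c: "complement r s"
  then show r: "r \<in> W" by (simp add: complement_def)
  from c have "(r, s) \<in> (R \<union> R\<inverse>)\<^sup>*" by (simp add: complement_def)
  then show "s \<in> W" by (cases rule: rtranclE) (use r in \<open>force simp: relation_words_def\<close>)+
qed

lemma complement_refl: "r \<in> W \<Longrightarrow> complement r r"
  by (simp add: complement_def)

lemma complement_sym: "complement r s \<Longrightarrow> complement s r"
proof -
  assume c: "complement r s"
  have "sym ((R \<union> R\<inverse>)\<^sup>*)" by (intro sym_rtrancl) (auto simp: sym_def)
  then show ?thesis using c complement_W[OF c] by (auto simp: complement_def dest: symD)
qed

lemma complement_trans: "complement r s \<Longrightarrow> complement s t \<Longrightarrow> complement r t"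
  by (auto simp: complement_def)

lemma pieceI:
  assumes "r \<in> W" "s \<in> W" "r = x @ p @ y" "s = x' @ p @ y'" "r \<noteq> s \<or> x \<noteq> x'"
  shows "piece R p"
proof (cases "r = s")
  case True
  then have "\<exists>r \<in> W. \<exists>x y x' y'. r = x @ p @ y \<and> r = x' @ p @ y' \<and> x \<noteq> x'" using assms by metis
  then show ?thesis unfolding piece_def by blast
next
  case False
  then have "sublist p r" "sublist p s" using assms by auto
  then show ?thesis unfolding piece_def using assms(1,2) False by blast
qed

lemma piece_factor:
  assumes "piece R (x @ p @ y)"
  shows "piece R p"
proof -
  let ?p = "x @ p @ y"
  consider "?p = []" | r s where "r \<in> W" "s \<in> W" "r \<noteq> s" "sublist ?p r" "sublist ?p s"
    | r a b a' b' where "r \<in> W" "r = a @ ?p @ b" "r = a' @ ?p @ b'" "a \<noteq> a'"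
    using assms unfolding piece_def by blast
  then show ?thesis
  proof cases
    case 1 then show ?thesis by (simp add: piece_def)
  next
    case 2
    then obtain a b a' b' where "r = a @ ?p @ b" "s = a' @ ?p @ b'" unfolding sublist_def by blast
    then have "r = (a @ x) @ p @ (y @ b)" "s = (a' @ x) @ p @ (y @ b')" by simp_all
    then show ?thesis using 2 pieceI by blast
  next
    case 3
    then have "r = (a @ x) @ p @ (y @ b)" "r = (a' @ x) @ p @ (y @ b')" "a @ x \<noteq> a' @ x" by simp_all
    then show ?thesis using 3 pieceI by blast
  qed
qed

lemma piece_Nil [simp]: "piece R []" by (simp add: piece_def)

lemma piece_prefix: "piece R (p @ y) \<Longrightarrow> piece R p"
  using piece_factor[of "[]"] by simp

lemma piece_suffix: "piece R (x @ p) \<Longrightarrow> piece R p"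
  using piece_factor[of x p "[]"] by simp

text \<open>The form in which C(4) is applied. As the empty word is a piece, products of fewer
  pieces are covered as well.\<close>

lemma not_three_pieces:
  assumes "a @ b @ c \<in> W" "piece R a" "piece R b" "piece R c"
  shows False
proof -
  have "length [a, b, c] < 4 \<and> (\<forall>p \<in> set [a, b, c]. piece R p) \<and> a @ b @ c = concat [a, b, c]"
    using assms by simp
  then show False using weakly_C4 assms(1) unfolding weakly_C_def by blast
qed

lemma not_two_pieces: "a @ b \<in> W \<Longrightarrow> piece R a \<Longrightarrow> piece R b \<Longrightarrow> False"
  using not_three_pieces[of a b "[]"] by simp

lemma not_piece: "r \<in> W \<Longrightarrow> \<not> piece R r"
  using not_three_pieces[of r "[]" "[]"] by auto

text \<open>In the usual notation \<open>r = XYZ\<close>, where \<open>X\<close> and \<open>Z\<close> are the longest piece prefix and suffix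
  of \<open>r\<close>, \<open>stem r\<close> is \<open>XY\<close> and \<open>tail r\<close> is \<open>Z\<close>.\<close>

definition tail :: "'a list \<Rightarrow> 'a list" where
  "tail r = (ARG_MAX length q. suffix q r \<and> piece R q)"

definition stem :: "'a list \<Rightarrow> 'a list" where
  "stem r = take (length r - length (tail r)) r"

lemma tail:
  shows suffix_tail: "suffix (tail r) r" and piece_tail [simp]: "piece R (tail r)"
    and tail_max: "suffix q r \<Longrightarrow> piece R q \<Longrightarrow> length q \<le> length (tail r)"
proof -
  have *: "suffix (tail r) r \<and> piece R (tail r)"
    and **: "\<And>q. suffix q r \<and> piece R q \<Longrightarrow> length q \<le> length (tail r)"
    unfolding tail_def
    by (rule arg_max_natI[of _ "[]" length "Suc (length r)"], auto simp: less_Suc_eq_le suffix_length_le)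
       (rule arg_max_nat_le[of _ _ length "Suc (length r)"], auto simp: less_Suc_eq_le suffix_length_le)
  show "suffix (tail r) r" "piece R (tail r)" using * by auto
  show "suffix q r \<Longrightarrow> piece R q \<Longrightarrow> length q \<le> length (tail r)" using ** by blast
qed

lemma stem_tail: "stem r @ tail r = r"
proof -
  obtain k where "r = k @ tail r" using suffix_tail[of r] by (auto simp: suffix_def)
  then show ?thesis unfolding stem_def by (metis append_eq_conv_conj diff_add_inverse2 length_append)
qed

lemma stem_not_two_pieces:
  assumes "r \<in> W" "stem r = a @ b" "piece R a" "piece R b"
  shows False
  using assms not_three_pieces[of a b "tail r"] stem_tail[of r] by simp

lemma stem_not_piece: "r \<in> W \<Longrightarrow> \<not> piece R (stem r)"
  using stem_not_two_pieces[of r "stem r" "[]"] by auto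

lemma stem_not_Nil: "r \<in> W \<Longrightarrow> stem r \<noteq> []"
  using stem_not_piece by fastforce

text \<open>Of two comparable stems of distinct relation words, the shorter one would occur in both
  words and so be a piece, which no stem is.\<close>

lemma stem_unique:
  assumes "r \<in> W" "s \<in> W" "stem r @ u = stem s @ v"
  shows "r = s"
proof (rule ccontr)
  assume ne: "r \<noteq> s"
  have rs: "r = [] @ stem r @ tail r" "s = [] @ stem s @ tail s" using stem_tail by simp_all
  from append_eq_split[OF assms(3)] obtain k where "stem r = stem s @ k \<or> stem s = stem r @ k"
    by blast
  then show False
  proof
    assume k: "stem r = stem s @ k"
    then have "r = [] @ stem s @ (k @ tail r)" using rs(1) by simp
    then have "piece R (stem s)" using pieceI[of r s "[]" "stem s"] rs ne assms by blast
    then show False using stem_not_piece assms by blast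
  next
    assume k: "stem s = stem r @ k"
    then have "s = [] @ stem r @ (k @ tail s)" using rs(2) by simp
    then have "piece R (stem r)" using pieceI[of s r "[]" "stem r"] rs ne assms by blast
    then show False using stem_not_piece assms by blast
  qed
qed

lemma stem_prefix_unique:
  assumes "r \<in> W" "s \<in> W" "stem r @ u = s @ v"
  shows "r = s"
  using stem_unique[OF assms(1,2), of u "tail s @ v"] assms(3) stem_tail[of s] by (metis append.assoc)

text \<open>Were \<open>stem t\<close> to end inside \<open>y\<close>, it would occur both strictly
  inside \<open>s\<close> and at the start of \<open>t\<close>, hence be a piece. So
  \<open>y\<close> is a prefix of \<open>stem t\<close> and itself occurs at these two
  places.\<close>

lemma overlap_stem:
  assumes "s \<in> W" "t \<in> W" "s = x @ y @ y2" "x \<noteq> []" "y @ u = stem t @ v"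
  shows "piece R y" "\<exists>k. stem t = y @ k \<and> u = k @ v"
proof -
  have t: "t = [] @ stem t @ tail t" using stem_tail by simp
  have no: "\<not> (\<exists>k. y = stem t @ k)"
  proof
    assume "\<exists>k. y = stem t @ k"
    then obtain k where "s = x @ stem t @ (k @ y2)" using assms(3) by auto
    then have "piece R (stem t)" using pieceI[of s t x "stem t" _ "[]"] t assms by blast
    then show False using stem_not_piece assms by blast
  qed
  then obtain k where k: "stem t = y @ k" "u = k @ v" using append_eq_split[OF assms(5)]
    by blast
  then show "\<exists>k. stem t = y @ k \<and> u = k @ v" by blast
  have "t = [] @ y @ (k @ tail t)" using t k by simp
  then show "piece R y" using pieceI[of s t x y y2 "[]"] assms by blast
qed

text \<open>The offsets \<open>length x\<close> and 0 differ, so \<open>s = t\<close> is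
  allowed.\<close>

lemma inner_prefix_piece:
  assumes "s \<in> W" "t \<in> W" "s = x @ y @ y2" "x \<noteq> []" "t = y @ z"
  shows "piece R y"
  using pieceI[of s t x y y2 "[]" z] assms by auto

lemma inner_relation_word:
  assumes "s \<in> W" "t \<in> W" "s = x @ t @ y2" "x \<noteq> []"
  shows False
  using inner_prefix_piece[of s t x t y2 "[]"] assms not_piece by simp

section \<open>Rewriting paths\<close>

definition rstep :: "'a list \<Rightarrow> 'a list \<Rightarrow> bool" where
  "rstep u v \<longleftrightarrow> (\<exists>a b r s. complement r s \<and> u = a @ r @ b \<and> v = a @ s @ b)"

abbreviation eqv :: "'a list \<Rightarrow> 'a list \<Rightarrow> bool" (infix "\<approx>" 50) where
  "eqv \<equiv> rstep\<^sup>*\<^sup>*"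

lemma rstep_sym: "rstep u v \<Longrightarrow> rstep v u"
  unfolding rstep_def using complement_sym by blast

lemma eqv_sym: "u \<approx> v \<Longrightarrow> v \<approx> u"
  by (induction rule: rtranclp_induct) (auto intro: rstep_sym converse_rtranclp_into_rtranclp)

lemma eqv_trans: "u \<approx> v \<Longrightarrow> v \<approx> w \<Longrightarrow> u \<approx> w"
  by (rule rtranclp_trans)

lemma rstep_context: "rstep u v \<Longrightarrow> rstep (a @ u @ b) (a @ v @ b)"
  unfolding rstep_def by (metis append.assoc)

lemma eqv_context: "u \<approx> v \<Longrightarrow> a @ u @ b \<approx> a @ v @ b"
  by (induction rule: rtranclp_induct) (auto intro: rstep_context rtranclp.rtrancl_into_rtrancl)

lemma eqv_append: "u \<approx> v \<Longrightarrow> a @ u \<approx> a @ v"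
  using eqv_context[of u v a "[]"] by simp

lemma complement_eqv: "complement r s \<Longrightarrow> r @ w \<approx> s @ w"
proof -
  assume "complement r s"
  then have "rstep (r @ w) (s @ w)" unfolding rstep_def by (metis append_Nil)
  then show ?thesis by blast
qed

lemma eqv_power: "(rstep ^^ n) u v \<Longrightarrow> u \<approx> v"
  by (rule relpowp_imp_rtranclp)

lemma rstep_append_cases:
  assumes "rstep (x @ y) v"
  obtains y' where "rstep y y'" "v = x @ y'"
  | x1 x2 r s b where "x = x1 @ x2" "x2 \<noteq> []" "x2 @ y = r @ b" "complement r s" "v = x1 @ s @ b"
proof -
  from assms obtain a b r s where *: "complement r s" "x @ y = a @ r @ b" "v = a @ s @ b"
    unfolding rstep_def by blast
  from *(2) consider us where "x = a @ us" "us \<noteq> []" "us @ y = r @ b" | us where "a = x @ us" "y = us @ r @ b"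
    using append_eq_split[OF *(2)] by (metis append_Nil append_Nil2)
  then show ?thesis
  proof cases
    case 1 then show ?thesis using that(2) * by blast
  next
    case 2
    then have "rstep y (us @ s @ b)" unfolding rstep_def using * by blast
    then show ?thesis using that(1) * 2 by simp
  qed
qed

text \<open>Some word congruent to \<open>w\<close> completes \<open>p\<close> to a relation word: the rewriting of \<open>p @ w\<close> can destroy \<open>p\<close>.\<close>

definition active :: "'a list \<Rightarrow> 'a list \<Rightarrow> bool" where
  "active p w \<longleftrightarrow> p \<noteq> [] \<and> piece R p \<and>
     (\<exists>t2 w2. p @ t2 \<in> W \<and> w \<approx> t2 @ w2)"

lemma active_eqv: "active p w \<Longrightarrow> w \<approx> w' \<Longrightarrow> active p w'"
  unfolding active_def by (meson eqv_sym eqv_trans)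

text \<open>Counting the steps makes this usable as an induction hypothesis; it is established for
  every \<open>n\<close> after \<open>stem_path\<close>.\<close>

definition stem_led :: "nat \<Rightarrow> bool" where
  "stem_led n \<longleftrightarrow> (\<forall>t w y. t \<in> W \<longrightarrow> (rstep ^^ n) (t @ w) y \<longrightarrow> (\<exists>t' y'. t' \<in> W \<and> y = stem t' @ y'))"

text \<open>The induction is joint: paths from \<open>p @ w\<close> of length \<open>n\<close> need \<open>stem_led\<close> for shorter paths from \<open>t @ w2\<close>,
  and \<open>stem_led n\<close> in turn rests on paths from \<open>tail r @ w\<close> of length below \<open>n\<close>.\<close>

lemma suffix_path:
  assumes "\<And>j. j < n \<Longrightarrow> stem_led j" "s0 \<in> W" "s0 = x0 @ p" "x0 \<noteq> []" "(rstep ^^ n) (p @ w) v"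
  shows "(\<exists>w'. v = p @ w' \<and> w \<approx> w') \<or>
    (\<exists>p1 p2 t2 w2 y j. p = p1 @ p2 \<and> p2 \<noteq> [] \<and> p2 @ t2 \<in> W \<and> w \<approx> t2 @ w2 \<and>
       j \<le> n \<and> (rstep ^^ j) (p2 @ t2 @ w2) y \<and> v = p1 @ y)"
  using assms(1,5)
proof (induction n arbitrary: v)
  case 0
  then show ?case by auto
next
  case (Suc n)
  from Suc.prems(2) obtain v0 where v0: "(rstep ^^ n) (p @ w) v0" "rstep v0 v" by auto
  have "(\<exists>w'. v0 = p @ w' \<and> w \<approx> w') \<or>
    (\<exists>p1 p2 t2 w2 y j. p = p1 @ p2 \<and> p2 \<noteq> [] \<and> p2 @ t2 \<in> W \<and> w \<approx> t2 @ w2 \<and>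
       j \<le> n \<and> (rstep ^^ j) (p2 @ t2 @ w2) y \<and> v0 = p1 @ y)"
    using Suc.IH[OF _ v0(1)] Suc.prems(1) by simp
  then show ?case
  proof (elim disjE exE conjE)
    fix w' assume w': "v0 = p @ w'" "w \<approx> w'"
    with v0(2) have "rstep (p @ w') v" by simp
    then show ?case
    proof (cases rule: rstep_append_cases)
      case (1 y')
      then have "w \<approx> y'" using w'(2) by (meson rtranclp.rtrancl_into_rtrancl)
      then show ?thesis using 1 by blast
    next
      case (2 p1 p2 r s b)
      have rW: "r \<in> W" using 2 complement_W by blast
      have "\<not> (\<exists>k. p2 = r @ k)"
      proof
        assume "\<exists>k. p2 = r @ k"
        then obtain k where "s0 = (x0 @ p1) @ r @ k" using assms(3) 2 by auto
        then show False using inner_relation_word[of s0 r "x0 @ p1" k] rW assms by blast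
      qed
      then obtain t2 where t2: "r = p2 @ t2" "w' = t2 @ b"
        using append_eq_split[OF 2(3)] by blast
      have "rstep (p2 @ t2 @ b) (s @ b)" using 2(4) t2 unfolding rstep_def
        by (metis append.assoc append_Nil)
      then have "(rstep ^^ 1) (p2 @ t2 @ b) (s @ b)" by (subst relpowp_1)
      moreover have "p2 @ t2 \<in> W" "w \<approx> t2 @ b" using rW t2 w' by simp_all
      ultimately show ?thesis using 2(1,2,5) by (metis One_nat_def Suc_le_mono zero_le)
    qed
  next
    fix p1 p2 t2 w2 y j
    assume h: "p = p1 @ p2" "p2 \<noteq> []" "p2 @ t2 \<in> W" "w \<approx> t2 @ w2" "j \<le> n"
      "(rstep ^^ j) (p2 @ t2 @ w2) y" "v0 = p1 @ y"
    from h Suc.prems(1)[of j] obtain t' y' where t': "t' \<in> W" "y = stem t' @ y'"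
      unfolding stem_led_def by (metis append.assoc le_imp_less_Suc)
    from v0(2) h have "rstep (p1 @ y) v" by simp
    then show ?case
    proof (cases rule: rstep_append_cases)
      case (1 y2)
      then have "(rstep ^^ Suc j) (p2 @ t2 @ w2) y2" using h by auto
      then show ?thesis using h 1 by (metis Suc_le_mono)
    next
      case (2 q1 q2 r s b)
      have rW: "r \<in> W" using 2 complement_W by blast
      have "\<not> (\<exists>k. q2 = r @ k)"
      proof
        assume "\<exists>k. q2 = r @ k"
        then obtain k where "s0 = (x0 @ q1) @ r @ (k @ p2)" using assms(3) 2 h by auto
        then show False using inner_relation_word[of s0 r "x0 @ q1"] rW assms by blast
      qed
      then obtain r2 where r2: "r = q2 @ r2" "y = r2 @ b"
        using append_eq_split[OF 2(3)] by blast
      \<comment> \<open>\<open>r2\<close> overlaps the stem at the front of \<open>y\<close>, and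
        \<open>q2\<close> lies inside \<open>s0\<close>: a relation word across the boundary of
        \<open>p1\<close> and \<open>y\<close> would be a product of two pieces.\<close>
      have "piece R r2" using overlap_stem(1)[of r t' q2 r2 "[]" b y'] rW t' r2 2(2) by simp
      moreover have "piece R q2"
        using inner_prefix_piece[of s0 r "x0 @ q1" q2 p2 r2] assms 2 h rW r2 by simp
      ultimately show ?thesis using not_two_pieces rW r2 by blast
    qed
  qed
qed

text \<open>A stem that starts properly inside the prefix \<open>stem r\<close> of \<open>stem r @ y\<close> and sticks out of it; when there is one,
  no congruent word starts with a relation word.\<close>

definition unclean :: "'a list \<Rightarrow> 'a list \<Rightarrow> bool" where
  "unclean r y \<longleftrightarrow> (\<exists>s h s1 s2 y'. s \<in> W \<and> h \<noteq> [] \<and> s1 \<noteq> [] \<and> stem r = h @ s1 \<and>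
     stem s = s1 @ s2 \<and> y = s2 @ y')"

text \<open>The overlap as a rewriting step meets it: the whole relation word \<open>s1 @ s2\<close>
  is present, whereas \<open>unclean\<close> asks only for its stem.\<close>

definition straddled :: "'a list \<Rightarrow> 'a list \<Rightarrow> bool" where
  "straddled r y \<longleftrightarrow> (\<exists>s1 s2 h y'. s1 @ s2 \<in> W \<and> h \<noteq> [] \<and> s1 \<noteq> [] \<and> stem r = h @ s1 \<and> y = s2 @ y')"

text \<open>The piece suffix \<open>e\<close> is no longer than the tail, so the stem ends before
  \<open>e\<close>; it does not end inside the piece \<open>s1\<close>, as a stem is no
  piece.\<close>

lemma split_stem:
  assumes "s1 @ q @ e \<in> W" "piece R s1" "piece R e"
  shows "\<exists>s2 k. stem (s1 @ q @ e) = s1 @ s2 \<and> q = s2 @ k"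
proof -
  let ?s = "s1 @ q @ e"
  have "length e \<le> length (tail ?s)" using tail_max assms by (simp add: suffix_def)
  moreover have "\<not> (\<exists>k. s1 = stem ?s @ k)"
    using assms stem_not_piece piece_prefix by metis
  moreover have eq: "stem ?s @ tail ?s = s1 @ (q @ e)" using stem_tail by simp
  ultimately obtain s2 where s2: "stem ?s = s1 @ s2" "q @ e = s2 @ tail ?s"
    using append_eq_split[OF eq] by blast
  have "length q + length e = length s2 + length (tail ?s)" using arg_cong[OF s2(2), of length] by simp
  then have "length s2 \<le> length q" using \<open>length e \<le> _\<close> by linarith
  then have "\<exists>k. q = s2 @ k" using append_eq_split[OF s2(2)] by fastforce
  then show ?thesis using s2 by blast
qed

lemma straddled_unclean:
  assumes "r \<in> W" "straddled r y"
  shows "unclean r y"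
proof -
  from assms(2) obtain s1 s2 h y' where h: "s1 @ s2 \<in> W" "h \<noteq> []" "s1 \<noteq> []" "stem r = h @ s1" "y = s2 @ y'"
    unfolding straddled_def by blast
  have "r = h @ s1 @ tail r" using stem_tail[of r] h by simp
  then have "piece R s1" using inner_prefix_piece[of r "s1 @ s2" h s1 "tail r" s2] h assms by simp
  then obtain q k where "stem (s1 @ s2) = s1 @ q" "s2 = q @ k" using split_stem[of s1 s2 "[]"] h by auto
  then show ?thesis unfolding unclean_def using h by (metis append.assoc)
qed

text \<open>There are three ways for an overlapping \<open>stem s\<close> to end. Within the
  untouched part of the tail, it lies inside \<open>r\<close> and is a piece. Beyond a wholly
  untouched tail, it makes \<open>s1 @ tail r\<close> a piece suffix of \<open>r\<close> longer than
  the tail. Inside a stem created by rewriting, it is a product of two pieces.\<close>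

lemma tail_path_clean:
  assumes "\<And>j. j \<le> n \<Longrightarrow> stem_led j" "r \<in> W" "(rstep ^^ n) (tail r @ w) y"
  shows "\<not> unclean r y"
proof
  assume "unclean r y"
  then obtain s h s1 s2 y' where s: "s \<in> W" "h \<noteq> []" "s1 \<noteq> []" "stem r = h @ s1" "stem s = s1 @ s2" "y = s2 @ y'"
    unfolding unclean_def by blast
  have r: "r = stem r @ tail r" using stem_tail by simp
  have s_eq: "s = s1 @ s2 @ tail s" using stem_tail[of s] s by simp
  have prefix_case: False if "tail r = s2 @ k" for k
  proof -
    have "r = h @ stem s @ k" using r s that by simp
    moreover have "s = stem s @ tail s" using stem_tail by simp
    ultimately have "piece R (stem s)" using inner_prefix_piece[of r s h "stem s" k] s assms by blast
    then show False using stem_not_piece s by blast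
  qed
  have "(\<exists>w'. y = tail r @ w' \<and> w \<approx> w') \<or>
    (\<exists>p1 p2 t2 w2 v j. tail r = p1 @ p2 \<and> p2 \<noteq> [] \<and> p2 @ t2 \<in> W \<and> w \<approx> t2 @ w2 \<and>
       j \<le> n \<and> (rstep ^^ j) (p2 @ t2 @ w2) v \<and> y = p1 @ v)"
    using suffix_path[of n r "stem r" "tail r" w y] assms r stem_not_Nil by simp
  then show False
  proof (elim disjE exE conjE)
    fix w' assume "y = tail r @ w'"
    then consider k where "tail r = s2 @ k" | k where "s2 = tail r @ k"
      using s(6) append_eq_split[of "tail r" w' s2 y'] by auto
    then show False
    proof cases
      case 2
      have "r = h @ (s1 @ tail r) @ []" using r s by simp
      moreover have "s = (s1 @ tail r) @ (k @ tail s)" using s_eq 2 by simp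
      ultimately have "piece R (s1 @ tail r)" using inner_prefix_piece[of r s h "s1 @ tail r"] s assms by blast
      moreover have "suffix (s1 @ tail r) r" using r s by (metis append.assoc suffixI)
      ultimately show False using tail_max[of "s1 @ tail r" r] s by simp
    qed (use prefix_case in blast)
  next
    fix p1 p2 t2 w2 v j
    assume h': "tail r = p1 @ p2" "p2 \<noteq> []" "p2 @ t2 \<in> W" "j \<le> n"
      "(rstep ^^ j) (p2 @ t2 @ w2) v" "y = p1 @ v"
    from h' assms(1)[of j] obtain t' v' where t': "t' \<in> W" "v = stem t' @ v'"
      unfolding stem_led_def by (metis append.assoc)
    from h'(6) s(6) consider k where "p1 = s2 @ k" | k where "s2 = p1 @ k" "k @ y' = v"
      using append_eq_split[of p1 v s2 y'] by auto
    then show False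
    proof cases
      case 1 then show False using prefix_case h' by simp
    next
      case 2
      have "piece R k" using overlap_stem(1)[of s t' "s1 @ p1" k "tail s" y' v'] s t' s_eq 2 by simp
      moreover have "r = h @ (s1 @ p1) @ p2" "s = (s1 @ p1) @ (k @ tail s)" using r s h' s_eq 2 by simp_all
      then have "piece R (s1 @ p1)" using inner_prefix_piece[of r s h "s1 @ p1"] s assms by blast
      ultimately show False using stem_not_two_pieces[of s "s1 @ p1" k] s 2 by simp
    qed
  qed
qed

text \<open>If \<open>tail_chain r w1 w2\<close> then \<open>r @ w1 \<approx> r @ w2\<close> by switching \<open>r\<close> to a complement, rewriting to the right of its
  stem, and so on.\<close>

definition tail_chain :: "'a list \<Rightarrow> 'a list \<Rightarrow> 'a list \<Rightarrow> bool" where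
  "tail_chain r = (\<lambda>w1 w2. \<exists>r1. complement r r1 \<and> tail r1 @ w1 \<approx> tail r1 @ w2)\<^sup>*\<^sup>*"

lemma tail_chain_refl: "w1 \<approx> w2 \<Longrightarrow> r \<in> W \<Longrightarrow> tail_chain r w1 w2"
  unfolding tail_chain_def using complement_refl eqv_append by blast

lemma tail_chain_step: "complement r r1 \<Longrightarrow> tail r1 @ w1 \<approx> tail r1 @ w2 \<Longrightarrow> tail_chain r w1 w2"
  unfolding tail_chain_def by blast

lemma tail_chain_trans: "tail_chain r w1 w2 \<Longrightarrow> tail_chain r w2 w3 \<Longrightarrow> tail_chain r w1 w3"
  unfolding tail_chain_def by (rule rtranclp_trans)

lemma tail_chain_sym: "tail_chain r w1 w2 \<Longrightarrow> tail_chain r w2 w1"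
  unfolding tail_chain_def
  by (induction rule: rtranclp_induct) (auto intro: converse_rtranclp_into_rtranclp eqv_sym)

text \<open>Straddling steps are excluded, so a step touching the leading stem starts at its first
  letter and switches the leading relation word to a complement. Before the first switch the rest
  develops from \<open>u'\<close>, later from the tail left by the last switch;
  \<open>tail_chain\<close> records what happened between switches.\<close>

lemma stem_path:
  assumes "r \<in> W"
    "\<And>m y. m < n \<Longrightarrow> (rstep ^^ m) u' y \<Longrightarrow> \<not> straddled r y"
    "\<And>m r w y. m < n \<Longrightarrow> r \<in> W \<Longrightarrow> (rstep ^^ m) (tail r @ w) y \<Longrightarrow> \<not> straddled r y"
    "(rstep ^^ n) (stem r @ u') v"
  shows "\<exists>r' v' m. complement r r' \<and> v = stem r' @ v' \<and> m \<le> n \<and>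
    (r' = r \<and> (rstep ^^ m) u' v' \<or>
     (\<exists>w1 w2. u' \<approx> tail r @ w1 \<and> tail_chain r w1 w2 \<and> (rstep ^^ m) (tail r' @ w2) v'))"
  using assms(2-4)
proof (induction n arbitrary: v)
  case 0
  then show ?case using complement_refl[OF assms(1)] by auto
next
  case (Suc n)
  from Suc.prems(3) obtain v0 where v0: "(rstep ^^ n) (stem r @ u') v0" "rstep v0 v" by auto
  have "\<exists>r' v' m. complement r r' \<and> v0 = stem r' @ v' \<and> m \<le> n \<and>
    (r' = r \<and> (rstep ^^ m) u' v' \<or>
     (\<exists>w1 w2. u' \<approx> tail r @ w1 \<and> tail_chain r w1 w2 \<and> (rstep ^^ m) (tail r' @ w2) v'))"
  proof (rule Suc.IH[OF _ _ v0(1)])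
    show "\<And>m y. m < n \<Longrightarrow> (rstep ^^ m) u' y \<Longrightarrow> \<not> straddled r y"
      using Suc.prems(1) by (meson less_SucI)
    show "\<And>m r w y. m < n \<Longrightarrow> r \<in> W \<Longrightarrow> (rstep ^^ m) (tail r @ w) y \<Longrightarrow> \<not> straddled r y"
      using Suc.prems(2) by (meson less_SucI)
  qed
  then obtain r1 v1 m where r1: "complement r r1" "v0 = stem r1 @ v1" "m \<le> n"
    and d: "r1 = r \<and> (rstep ^^ m) u' v1 \<or>
     (\<exists>w1 w2. u' \<approx> tail r @ w1 \<and> tail_chain r w1 w2 \<and> (rstep ^^ m) (tail r1 @ w2) v1)"
    by blast
  have r1W: "r1 \<in> W" using r1 complement_W by blast
  from v0(2) r1 have "rstep (stem r1 @ v1) v" by simp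
  then show ?case
  proof (cases rule: rstep_append_cases)
    case (1 y')
    have "r1 = r \<and> (rstep ^^ Suc m) u' y' \<or>
     (\<exists>w1 w2. u' \<approx> tail r @ w1 \<and> tail_chain r w1 w2 \<and> (rstep ^^ Suc m) (tail r1 @ w2) y')"
      using d 1 by auto
    then show ?thesis using r1 1 by (metis Suc_le_mono)
  next
    case (2 x1 x2 s s' b)
    have sW: "s \<in> W" using 2 complement_W by blast
    show ?thesis
    proof (cases "x1 = []")
      case False
      have "\<not> (\<exists>k. x2 = s @ k)"
      proof
        assume "\<exists>k. x2 = s @ k"
        then obtain k where "stem r1 = x1 @ s @ k" using 2 by auto
        then have "r1 = x1 @ s @ (k @ tail r1)" using stem_tail[of r1] by simp
        then show False using inner_relation_word[of r1 s x1] r1W sW False by blast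
      qed
      then obtain s2 where "s = x2 @ s2" "v1 = s2 @ b" using append_eq_split[OF 2(3)] by blast
      then have "straddled r1 v1" unfolding straddled_def using 2 False sW by blast
      \<comment> \<open>The overlap is already present before the last step, so the exclusion is
        needed for shorter paths only, as the joint induction provides it.\<close>
      moreover have "m < Suc n" using r1 by simp
      ultimately have "\<not> (rstep ^^ m) (tail r1 @ w) v1" "\<not> (r1 = r \<and> (rstep ^^ m) u' v1)" for w
        using Suc.prems(1,2) r1W by auto
      then show ?thesis using d by simp
    next
      case True
      then have *: "stem r1 @ v1 = s @ b" using 2 by simp
      then have "s = r1" using stem_prefix_unique r1W sW by blast
      then have v1: "v1 = tail r1 @ b" using * stem_tail[of r1] by (metis append.assoc same_append_eq)
      have c: "complement r s'" using r1 2 \<open>s = r1\<close> complement_trans by blast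
      \<comment> \<open>A switch needs the rest to be \<open>tail r1 @ b\<close>. What happened
        since the previous switch becomes one link of the chain; at the first switch
        \<open>w1 = b\<close>.\<close>
      have "\<exists>w1. u' \<approx> tail r @ w1 \<and> tail_chain r w1 b"
        using d
      proof (elim disjE exE conjE)
        assume "r1 = r" "(rstep ^^ m) u' v1"
        then have "u' \<approx> tail r @ b" using v1 eqv_power by simp
        then show ?thesis using tail_chain_refl[OF _ assms(1)] by blast
      next
        fix w1 w2 assume h: "u' \<approx> tail r @ w1" "tail_chain r w1 w2" "(rstep ^^ m) (tail r1 @ w2) v1"
        then have "tail_chain r w2 b" using tail_chain_step[OF r1(1)] v1 eqv_power by simp
        then show ?thesis using tail_chain_trans h by blast
      qed
      moreover have "v = stem s' @ tail s' @ b" using True 2 stem_tail[of s'] by (metis append.assoc append_Nil)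
      moreover have "(rstep ^^ 0) (tail s' @ b) (tail s' @ b)" by simp
      ultimately show ?thesis using c by (metis zero_le)
    qed
  qed
qed

text \<open>Closes the joint induction: for paths shorter than \<open>n\<close>,
  \<open>tail_path_clean\<close> asks only for \<open>stem_led\<close> below \<open>n\<close>, and
  it excludes the straddling steps in \<open>stem_path\<close>.\<close>

lemma stem_led: "stem_led n"
proof (induction n rule: less_induct)
  case (less n)
  show ?case unfolding stem_led_def
  proof (intro allI impI)
    fix t w y assume t: "t \<in> W" "(rstep ^^ n) (t @ w) y"
    have ns: "\<not> straddled r y" if "m < n" "r \<in> W" "(rstep ^^ m) (tail r @ w) y" for m r w y
      using tail_path_clean[of m r w y] less that straddled_unclean by (meson le_less_trans)
    from t have "(rstep ^^ n) (stem t @ (tail t @ w)) y" using stem_tail[of t] by (metis append.assoc)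
    from stem_path[OF t(1) _ _ this] ns t(1) have "\<exists>r' v'. complement t r' \<and> y = stem r' @ v'" by blast
    then show "\<exists>t' y'. t' \<in> W \<and> y = stem t' @ y'" using complement_W by blast
  qed
qed

section \<open>Congruences of words starting with a suffix of a relation word\<close>

lemma suffix_eqv:
  assumes "s0 \<in> W" "s0 = x0 @ p" "x0 \<noteq> []" "p @ w \<approx> v"
  shows "(\<exists>w'. v = p @ w' \<and> w \<approx> w') \<or>
    (\<exists>p1 p2 y. p = p1 @ p2 \<and> active p2 w \<and> p2 @ w \<approx> y \<and> v = p1 @ y)"
proof -
  obtain n where n: "(rstep ^^ n) (p @ w) v" using assms(4) rtranclp_imp_relpowp by metis
  from suffix_path[OF stem_led assms(1-3) n] show ?thesis
  proof (elim disjE exE conjE)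
    fix p1 p2 t2 w2 y j
    assume h: "p = p1 @ p2" "p2 \<noteq> []" "p2 @ t2 \<in> W" "w \<approx> t2 @ w2"
      "(rstep ^^ j) (p2 @ t2 @ w2) y" "v = p1 @ y"
    have "s0 = (x0 @ p1) @ p2 @ []" using assms h by simp
    then have "piece R p2" using inner_prefix_piece[of s0 "p2 @ t2" "x0 @ p1" p2 "[]" t2] h assms by simp
    then have "active p2 w" unfolding active_def using h by blast
    moreover have "p2 @ w \<approx> y" using eqv_append[OF h(4), of p2] eqv_power[OF h(5)] eqv_trans by blast
    ultimately show ?thesis using h by blast
  qed blast
qed

text \<open>Rewriting can destroy only an active suffix of \<open>t2\<close>, and active words are
  pieces. So \<open>w\<close> itself shows all of \<open>t2\<close> but a piece.\<close>

lemma relation_suffix_prefix: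
  assumes "p @ t2 \<in> W" "p \<noteq> []" "w \<approx> t2 @ w2"
  shows "\<exists>q e. t2 = q @ e \<and> piece R e \<and> prefix q w"
  using suffix_eqv[OF assms(1) HOL.refl assms(2) eqv_sym[OF assms(3)]]
proof (elim disjE exE conjE)
  fix w' assume "w = t2 @ w'"
  then show ?thesis by (intro exI[of _ t2] exI[of _ "[]"]) simp
next
  fix p1 p2 y assume "t2 = p1 @ p2" "active p2 w2" "w = p1 @ y"
  then show ?thesis unfolding active_def by (intro exI[of _ p1] exI[of _ p2]) simp
qed

text \<open>A necessary condition for \<open>active p w\<close> that depends on a bounded prefix of the word \<open>w\<close> itself and, by \<open>C(4)\<close>,
  determines \<open>p\<close>: two candidates would make \<open>q\<close> a piece and \<open>p @ q @ e\<close> a product of three.\<close>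

definition candidate :: "'a list \<Rightarrow> 'a list \<Rightarrow> bool" where
  "candidate p w \<longleftrightarrow> p \<noteq> [] \<and> piece R p \<and> (\<exists>q e. p @ q @ e \<in> W \<and> piece R e \<and> prefix q w)"

lemma active_candidate: "active p w \<Longrightarrow> candidate p w"
  unfolding active_def candidate_def using relation_suffix_prefix by metis

lemma candidate_unique:
  assumes "candidate p w" "candidate p' w"
  shows "p = p'"
proof -
  have *: "p = p'" if "p @ q @ e \<in> W" "p' @ q' @ e' \<in> W" "piece R p" "piece R e" "prefix q q'"
    for p q e p' q' e'
  proof (rule ccontr)
    assume "p \<noteq> p'"
    moreover from that obtain k where "q' = q @ k" by (auto simp: prefix_def)
    ultimately have "piece R q"
      using pieceI[of "p @ q @ e" "p' @ q' @ e'" p q e p' "k @ e'"] that by simp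
    then show False using not_three_pieces that by blast
  qed
  obtain q e q' e' where h: "piece R p" "p @ q @ e \<in> W" "piece R e" "prefix q w"
    "piece R p'" "p' @ q' @ e' \<in> W" "piece R e'" "prefix q' w"
    using assms unfolding candidate_def by blast
  then have "prefix q q' \<or> prefix q' q" using prefix_same_cases by blast
  then show ?thesis using * h by metis
qed

lemma active_unique: "active p w \<Longrightarrow> active p' w \<Longrightarrow> p = p'"
  using active_candidate candidate_unique by blast

text \<open>If a proper suffix \<open>b\<close> of \<open>p = a @ b\<close> were active instead,
  \<open>b @ t2\<close> would overlap a stem from the front and be a piece, making
  \<open>p @ t2\<close> the product of the pieces \<open>a\<close> and
  \<open>b @ t2\<close>.\<close>

lemma active_transfer:
  assumes "s0 \<in> W" "s0 = x0 @ p" "x0 \<noteq> []" "active p w" "p @ w \<approx> p @ w'"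
  shows "active p w'"
proof -
  from assms(4) obtain t2 x where t: "p \<noteq> []" "piece R p" "p @ t2 \<in> W" "w \<approx> t2 @ x"
    unfolding active_def by blast
  have "p @ w' \<approx> p @ t2 @ x" using assms(5) eqv_append[OF t(4), of p] eqv_sym eqv_trans by blast
  from suffix_eqv[OF assms(1-3) this] show ?thesis
  proof (elim disjE exE conjE)
    fix w'' assume "p @ t2 @ x = p @ w''" "w' \<approx> w''"
    then show ?thesis using t unfolding active_def by auto
  next
    fix a b y assume h: "p = a @ b" "active b w'" "b @ w' \<approx> y" "p @ t2 @ x = a @ y"
    then have y: "y = (b @ t2) @ x" by simp
    from h(2) obtain t2' w2 where t': "b @ t2' \<in> W" "w' \<approx> t2' @ w2" unfolding active_def by blast
    have "(b @ t2') @ w2 \<approx> y" using eqv_trans[OF eqv_sym[OF eqv_append[OF t'(2), of b]] h(3)] by simp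
    then obtain n where "(rstep ^^ n) ((b @ t2') @ w2) y" using rtranclp_imp_relpowp by metis
    then obtain t'' y' where t'': "t'' \<in> W" "y = stem t'' @ y'" using stem_led[of n] t' unfolding stem_led_def by blast
    show ?thesis
    proof (cases "a = []")
      case True then show ?thesis using h by simp
    next
      case False
      have "piece R (b @ t2)"
        using overlap_stem(1)[of "p @ t2" t'' a "b @ t2" "[]" x y'] t t'' h y False by simp
      moreover have "piece R a" using piece_prefix t(2) h(1) by blast
      ultimately show ?thesis using not_two_pieces[of a "b @ t2"] t h by simp
    qed
  qed
qed

section \<open>Cancelling tails and collapsing chains of switches\<close>

lemma tail_cancel:
  assumes "r \<in> W" "tail r @ w1 \<approx> tail r @ w2"
  shows "w1 \<approx> w2 \<or> (\<exists>p. suffix p (tail r) \<and> active p w1 \<and> active p w2 \<and> p @ w1 \<approx> p @ w2)"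
proof -
  have r: "r = stem r @ tail r" "stem r \<noteq> []" using stem_tail stem_not_Nil[OF assms(1)] by auto
  from suffix_eqv[OF assms(1) r assms(2)] show ?thesis
  proof (elim disjE exE conjE)
    fix p1 p2 y
    assume h: "tail r = p1 @ p2" "active p2 w1" "p2 @ w1 \<approx> y" "tail r @ w2 = p1 @ y"
    have e: "p2 @ w1 \<approx> p2 @ w2" using h by simp
    moreover have "r = (stem r @ p1) @ p2" using r h by (metis append.assoc)
    then have "active p2 w2" using active_transfer[OF assms(1) _ _ h(2) e] r by blast
    ultimately show ?thesis using h by (metis suffixI)
  qed auto
qed

text \<open>Links whose tail cancels are plain congruences. The others all involve the same active
  word, by \<open>active_unique\<close>, so they compose to one congruence with that word in
  front.\<close>

lemma tail_chain_cases:
  assumes "tail_chain r w1 w2"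
  shows "w1 \<approx> w2 \<or> (\<exists>p r1. complement r r1 \<and> suffix p (tail r1) \<and> active p w1 \<and> active p w2 \<and> p @ w1 \<approx> p @ w2)"
  using assms unfolding tail_chain_def
proof (induction rule: rtranclp_induct)
  case (step w2 w3)
  then obtain r1 where r1: "complement r r1" "tail r1 @ w2 \<approx> tail r1 @ w3" by blast
  from tail_cancel[OF complement_W(2)[OF r1(1)] r1(2)] step.IH show ?case
  proof (elim disjE exE conjE)
    assume "w2 \<approx> w3" "w1 \<approx> w2" then show ?thesis using eqv_trans by blast
  next
    fix p r2 assume "w2 \<approx> w3" "complement r r2" "suffix p (tail r2)" "active p w1" "active p w2" "p @ w1 \<approx> p @ w2"
    then show ?thesis using active_eqv eqv_append eqv_trans by metis
  next
    fix p assume "suffix p (tail r1)" "active p w2" "active p w3" "p @ w2 \<approx> p @ w3" "w1 \<approx> w2"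
    then show ?thesis using active_eqv eqv_append eqv_trans eqv_sym r1(1) by metis
  next
    fix p p' r2
    assume "suffix p (tail r1)" "active p w2" "active p w3" "p @ w2 \<approx> p @ w3"
      "complement r r2" "suffix p' (tail r2)" "active p' w1" "active p' w2" "p' @ w1 \<approx> p' @ w2"
    then show ?thesis using active_unique[of p w2 p'] eqv_trans by metis
  qed
qed simp

lemma tail_chain_eqv_active:
  assumes "tail_chain r w1 w2" "active p w1" "suffix p x"
  shows "x @ w1 \<approx> x @ w2" "active p w2"
proof -
  obtain k where k: "x = k @ p" using assms by (auto simp: suffix_def)
  have "p @ w1 \<approx> p @ w2 \<and> active p w2"
    using tail_chain_cases[OF assms(1)] active_unique[OF assms(2)] assms(2) active_eqv eqv_append by metis
  then show "x @ w1 \<approx> x @ w2" "active p w2" using k eqv_append[of "p @ w1" "p @ w2" k] by simp_all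
qed

lemma stem_eqv: "tail r @ w1 \<approx> tail r @ w2 \<Longrightarrow> r @ w1 \<approx> r @ w2"
  using eqv_append[of "tail r @ w1" "tail r @ w2" "stem r"] stem_tail[of r] by (metis append.assoc)

lemma tail_chain_relation:
  assumes "tail_chain r w1 w2"
  shows "r @ w1 \<approx> r @ w2"
  using assms unfolding tail_chain_def
proof (induction rule: rtranclp_induct)
  case (step w2 w3)
  then obtain r1 where "complement r r1" "r1 @ w2 \<approx> r1 @ w3" using stem_eqv by blast
  then have "r @ w2 \<approx> r @ w3" using complement_eqv eqv_trans eqv_sym by metis
  then show ?case using step eqv_trans by blast
qed simp

text \<open>Starting from \<open>stem t @ (tail t @ w)\<close>, both alternatives of
  \<open>stem_path\<close> derive the rest from a word beginning with the tail of the present stem,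
  and \<open>tail_path_clean\<close> applies.\<close>

lemma active_clean_stem:
  assumes "t \<in> W" "u \<approx> t @ w"
  shows "\<exists>r u'. r \<in> W \<and> u = stem r @ u' \<and> \<not> unclean r u'"
proof -
  obtain n where "(rstep ^^ n) (t @ w) u" using eqv_sym[OF assms(2)] rtranclp_imp_relpowp by metis
  then have n: "(rstep ^^ n) (stem t @ (tail t @ w)) u" using stem_tail[of t] by (metis append.assoc)
  have ns: "\<not> straddled r y" if "r \<in> W" "(rstep ^^ m) (tail r @ w) y" for m r w y
    using tail_path_clean[OF stem_led that] that straddled_unclean by blast
  have "\<exists>r' v' m. complement t r' \<and> u = stem r' @ v' \<and> m \<le> n \<and>
    (r' = t \<and> (rstep ^^ m) (tail t @ w) v' \<or>
     (\<exists>w1 w2. tail t @ w \<approx> tail t @ w1 \<and> tail_chain t w1 w2 \<and> (rstep ^^ m) (tail r' @ w2) v'))"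
    by (rule stem_path[OF assms(1) _ _ n]) (use ns assms(1) in blast)+
  then obtain r' v' m w2 where
    "complement t r'" "u = stem r' @ v'" "(rstep ^^ m) (tail r' @ w2) v'" by blast
  then show ?thesis using tail_path_clean[OF stem_led] complement_W by blast
qed

lemma clean_eqv:
  assumes "r \<in> W" "\<not> unclean r u'" "stem r @ u' \<approx> v"
  shows "\<exists>r' v'. complement r r' \<and> v = stem r' @ v' \<and>
    (r' = r \<and> u' \<approx> v' \<or> (\<exists>w1 w2. u' \<approx> tail r @ w1 \<and> tail_chain r w1 w2 \<and> v' \<approx> tail r' @ w2))"
proof -
  have ns: "\<not> straddled r y" if "r \<in> W" "(rstep ^^ m) (tail r @ w) y" for m r w y
    using tail_path_clean[OF stem_led that] that straddled_unclean by blast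
  \<comment> \<open>\<open>unclean\<close> speaks of \<open>u'\<close> itself, while straddling must
    be excluded after any rewriting of the rest. All of \<open>s2\<close> except a piece is already
    visible in \<open>u'\<close>, and the stem of \<open>s1 @ s2\<close> ends before that
    piece.\<close>
  have nu: "\<not> straddled r y" if uy: "u' \<approx> y" for y
  proof
    assume "straddled r y"
    then obtain s1 s2 h y' where s: "s1 @ s2 \<in> W" "h \<noteq> []" "s1 \<noteq> []" "stem r = h @ s1" "y = s2 @ y'"
      unfolding straddled_def by blast
    have "r = h @ s1 @ tail r" using stem_tail[of r] s by simp
    then have "piece R s1" using inner_prefix_piece[of r "s1 @ s2" h s1 "tail r" s2] s assms by simp
    moreover obtain q e where q: "s2 = q @ e" "piece R e" "prefix q u'"
      using relation_suffix_prefix[OF s(1,3), of u' y'] uy s(5) by auto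
    ultimately obtain s2' k where k: "stem (s1 @ s2) = s1 @ s2'" "q = s2' @ k"
      using split_stem[of s1 q e] s(1) by auto
    obtain x where "u' = s2' @ (k @ x)" using q(3) k(2) by (auto simp: prefix_def)
    then have "unclean r u'" unfolding unclean_def using s(1-4) k(1) by blast
    then show False using assms(2) by blast
  qed
  obtain n where n: "(rstep ^^ n) (stem r @ u') v" using assms(3) rtranclp_imp_relpowp by metis
  have "\<exists>r' v' m. complement r r' \<and> v = stem r' @ v' \<and> m \<le> n \<and>
    (r' = r \<and> (rstep ^^ m) u' v' \<or>
     (\<exists>w1 w2. u' \<approx> tail r @ w1 \<and> tail_chain r w1 w2 \<and> (rstep ^^ m) (tail r' @ w2) v'))"
  proof (rule stem_path[OF assms(1) _ _ n])
    show "\<not> straddled r y" if "(rstep ^^ m) u' y" for m y using nu[OF eqv_power[OF that]] .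
    show "\<not> straddled r y" if "r \<in> W" "(rstep ^^ m) (tail r @ w) y" for m r w y using ns[OF that] .
  qed
  then obtain r' v' m where h: "complement r r'" "v = stem r' @ v'"
    "r' = r \<and> (rstep ^^ m) u' v' \<or>
     (\<exists>w1 w2. u' \<approx> tail r @ w1 \<and> tail_chain r w1 w2 \<and> (rstep ^^ m) (tail r' @ w2) v')" by blast
  have "r' = r \<and> u' \<approx> v' \<or> (\<exists>w1 w2. u' \<approx> tail r @ w1 \<and> tail_chain r w1 w2 \<and> v' \<approx> tail r' @ w2)"
    using h(3)
  proof (elim disjE exE conjE)
    fix w1 w2 assume "u' \<approx> tail r @ w1" "tail_chain r w1 w2" "(rstep ^^ m) (tail r' @ w2) v'"
    then show ?thesis using eqv_sym[OF eqv_power] by blast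
  qed (use eqv_power in blast)
  then show ?thesis using h by blast
qed

lemma clean_eqv_iff:
  assumes "r \<in> W" "\<not> unclean r u'" "complement r r'"
  shows "stem r @ u' \<approx> stem r' @ v' \<longleftrightarrow>
    (r' = r \<and> u' \<approx> v' \<or> (\<exists>w1 w2. u' \<approx> tail r @ w1 \<and> tail_chain r w1 w2 \<and> v' \<approx> tail r' @ w2))"
    (is "?L \<longleftrightarrow> ?A \<or> ?B")
proof
  assume ?L
  from clean_eqv[OF assms(1,2) this] obtain r2 v2 where r2: "complement r r2" "stem r' @ v' = stem r2 @ v2"
    "r2 = r \<and> u' \<approx> v2 \<or> (\<exists>w1 w2. u' \<approx> tail r @ w1 \<and> tail_chain r w1 w2 \<and> v2 \<approx> tail r2 @ w2)" by blast
  have "r' = r2" using stem_unique r2 complement_W assms by blast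
  then show "?A \<or> ?B" using r2 by simp
next
  have *: ?L if "u' \<approx> tail r @ w1" "tail_chain r w1 w2" "v' \<approx> tail r' @ w2" for w1 w2
  proof -
    have "stem r @ u' \<approx> r @ w1" using eqv_append[OF that(1), of "stem r"] stem_tail[of r] by (metis append.assoc)
    moreover have "stem r' @ v' \<approx> r' @ w2" using eqv_append[OF that(3), of "stem r'"] stem_tail[of r'] by (metis append.assoc)
    moreover have "r @ w1 \<approx> r' @ w2" using tail_chain_relation[OF that(2)] complement_eqv[OF assms(3)] eqv_trans by blast
    ultimately show ?L using eqv_trans eqv_sym by blast
  qed
  assume "?A \<or> ?B"
  then show ?L using * eqv_append by blast
qed

section \<open>Reducing the comparison of two words\<close>

definition possible_prefix :: "'a list \<Rightarrow> 'a list \<Rightarrow> bool" where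
  "possible_prefix z u \<longleftrightarrow> (\<exists>w. u \<approx> z @ w)"

lemma possible_prefix_Nil [simp]: "possible_prefix [] u"
  unfolding possible_prefix_def by auto

text \<open>Symmetric in \<open>u\<close> and \<open>v\<close>, as \<open>possible_prefix z\<close>
  passes to congruent words.\<close>

definition agree :: "'a list \<Rightarrow> 'a list \<Rightarrow> 'a list \<Rightarrow> bool" where
  "agree u v z \<longleftrightarrow> u \<approx> v \<and> possible_prefix z u"

lemma eqv_Nil: "[] \<approx> v \<longleftrightarrow> v = []"
proof
  assume "[] \<approx> v"
  then show "v = []"
  proof (induction rule: rtranclp_induct)
    case (step y z)
    then obtain a b r s where "complement r s" "[] = a @ r @ b" unfolding rstep_def by blast
    then show ?case using not_piece[of r] complement_W(1)[of r s] by simp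
  qed simp
qed simp

lemma agree_Nil: "agree [] v z \<longleftrightarrow> v = [] \<and> z = []" "agree u [] z \<longleftrightarrow> u = [] \<and> z = []"
proof -
  have *: "u \<approx> [] \<longleftrightarrow> u = []" for u using eqv_Nil[of u] eqv_sym[of u "[]"] eqv_sym[of "[]" u] by blast
  have "possible_prefix z [] \<longleftrightarrow> z = []" unfolding possible_prefix_def eqv_Nil by simp
  then show "agree [] v z \<longleftrightarrow> v = [] \<and> z = []" "agree u [] z \<longleftrightarrow> u = [] \<and> z = []"
    unfolding agree_def eqv_Nil * by auto
qed

text \<open>A step that touches the first letter needs a relation word at the front, and then
  \<open>active_clean_stem\<close> yields a clean stem at the front of \<open>a # u\<close>. So the
  first letter is fixed and can be removed.\<close>

lemma agree_strip:
  assumes "\<And>r u'. r \<in> W \<Longrightarrow> a # u = stem r @ u' \<Longrightarrow> unclean r u'"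
  shows "agree (a # u) (b # v) z \<longleftrightarrow> a = b \<and> (z = [] \<or> hd z = a) \<and> agree u v (tl z)"
proof -
  have *: "\<exists>x'. x = a # x' \<and> u \<approx> x'" if "a # u \<approx> x" for x
    using that
  proof (induction rule: rtranclp_induct)
    case (step y x)
    then obtain y' where y': "y = [a] @ y'" "u \<approx> y'" by auto
    with step(2) have "rstep ([a] @ y') x" by simp
    then show ?case
    proof (cases rule: rstep_append_cases)
      case (1 y2) then show ?thesis using y' by (auto intro: rtranclp.rtrancl_into_rtrancl)
    next
      case (2 x1 x2 r s b)
      then have "y = r @ b" using y' by (cases x1) auto
      then have "a # u \<approx> r @ b" using step(1) by simp
      then show ?thesis using active_clean_stem[of r "a # u" b] 2 complement_W assms by blast
    qed
  qed simp
  have **: "a # u \<approx> a # x" if "u \<approx> x" for x using eqv_append[OF that, of "[a]"] by simp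
  have "possible_prefix z (a # u) \<longleftrightarrow> (z = [] \<or> hd z = a) \<and> possible_prefix (tl z) u"
  proof (cases z)
    case (Cons c z')
    then show ?thesis unfolding possible_prefix_def using * ** by fastforce
  qed simp
  moreover have "a # u \<approx> b # v \<longleftrightarrow> a = b \<and> u \<approx> v" using * ** by blast
  ultimately show ?thesis unfolding agree_def by blast
qed

text \<open>A piece contains no stem, so \<open>z\<close> must fit into the leading stem. This is
  \<open>stem r\<close> or, after a switch, the stem of a complement; switching requires
  \<open>tail r\<close> to be a possible prefix of the rest.\<close>

lemma clean_possible_prefix:
  assumes "r \<in> W" "\<not> unclean r u'" "piece R z"
  shows "possible_prefix z (stem r @ u') \<longleftrightarrow>
    prefix z (stem r) \<or> (\<exists>r'. complement r r' \<and> prefix z (stem r')) \<and> possible_prefix (tail r) u'" (is "?L \<longleftrightarrow> ?A \<or> ?B")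
proof
  assume ?L
  then obtain w where "stem r @ u' \<approx> z @ w" unfolding possible_prefix_def by blast
  from clean_eqv[OF assms(1,2) this] obtain r' v' where r': "complement r r'" "z @ w = stem r' @ v'"
    "r' = r \<and> u' \<approx> v' \<or> (\<exists>w1 w2. u' \<approx> tail r @ w1 \<and> tail_chain r w1 w2 \<and> v' \<approx> tail r' @ w2)" by blast
  have "\<not> (\<exists>k. z = stem r' @ k)" using assms(3) piece_prefix stem_not_piece complement_W r' by blast
  then have "prefix z (stem r')" using append_eq_split[OF r'(2)] by (auto simp: prefix_def)
  then show "?A \<or> ?B" using r' unfolding possible_prefix_def by blast
next
  assume "?A \<or> ?B"
  then show ?L
  proof (elim disjE exE conjE)
    assume "prefix z (stem r)" then show ?L unfolding possible_prefix_def by (auto simp: prefix_def)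
  next
    fix r' assume h: "complement r r'" "prefix z (stem r')" "possible_prefix (tail r) u'"
    then obtain w1 where "u' \<approx> tail r @ w1" unfolding possible_prefix_def by blast
    then have "stem r @ u' \<approx> r @ w1" using eqv_append[of u' "tail r @ w1" "stem r"] stem_tail[of r] by (metis append.assoc)
    then have "stem r @ u' \<approx> r' @ w1" using complement_eqv h eqv_trans by blast
    then have "stem r @ u' \<approx> stem r' @ (tail r' @ w1)" using stem_tail[of r'] by (metis append.assoc)
    moreover obtain k where "stem r' = z @ k" using h by (auto simp: prefix_def)
    ultimately show ?L unfolding possible_prefix_def by auto
  qed
qed

section \<open>Comparison behind the stems, by whether the tails follow literally\<close>

lemma not_literal_active:
  assumes "r \<in> W" "u' \<approx> tail r @ w1" "\<not> prefix (tail r) u'"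
  obtains p1 p2 y where "tail r = p1 @ p2" "active p2 w1" "p2 @ w1 \<approx> y" "u' = p1 @ y" "suffix p2 (tail r)"
proof -
  have r: "r = stem r @ tail r" "stem r \<noteq> []" using stem_tail stem_not_Nil[OF assms(1)] by auto
  show ?thesis using suffix_eqv[OF assms(1) r eqv_sym[OF assms(2)]] that assms(3)
    by (auto simp: suffix_def)
qed

lemma agree_stem_complement:
  assumes "r \<in> W" "\<not> unclean r u'" "piece R z" "agree (stem r @ u') v z"
  shows "\<exists>r' v'. complement r r' \<and> v = stem r' @ v'" "\<exists>r'. complement r r' \<and> prefix z (stem r')"
  using clean_eqv[OF assms(1,2)] clean_possible_prefix[OF assms(1-3)] assms(4) complement_refl[OF assms(1)]
  unfolding agree_def by blast+

text \<open>A possible switch to \<open>r2\<close> brings \<open>z\<close> to the front, so only the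
  congruence is left to check.\<close>

lemma agree_switched:
  assumes "r \<in> W" "\<not> unclean r u'" "piece R z" "complement r r'" "complement r r2" "prefix z (stem r2)"
    "possible_prefix (tail r) u'"
  shows "agree (stem r @ u') (stem r' @ v') z \<longleftrightarrow> stem r @ u' \<approx> stem r' @ v'"
  unfolding agree_def using clean_possible_prefix[OF assms(1-3)] assms by blast

text \<open>If \<open>rs\<close> is a complement whose tail ends in the active word of \<open>w1\<close>, a chain of switches collapses to
  one rewriting to the right of \<open>stem rs\<close>.\<close>

lemma agree_both_literal:
  assumes "r \<in> W" "\<not> unclean r (tail r @ w1)" "piece R z" "complement r r'" "complement r r2" "prefix z (stem r2)"
    and rs: "complement r rs" "\<And>p r1. complement r r1 \<Longrightarrow> suffix p (tail r1) \<Longrightarrow> active p w1 \<Longrightarrow> suffix p (tail rs)"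
  shows "agree (stem r @ tail r @ w1) (stem r' @ tail r' @ w2) z \<longleftrightarrow> agree (tail rs @ w1) (tail rs @ w2) []"
proof -
  have "possible_prefix (tail r) (tail r @ w1)" unfolding possible_prefix_def by blast
  then have "agree (stem r @ tail r @ w1) (stem r' @ tail r' @ w2) z \<longleftrightarrow> stem r @ tail r @ w1 \<approx> stem r' @ tail r' @ w2"
    using agree_switched assms by blast
  also have "\<dots> \<longleftrightarrow> tail_chain r w1 w2"
    unfolding clean_eqv_iff[OF assms(1,2,4)]
  \<comment> \<open>Congruences with the tail of a complement in front are links, so they extend the
    chain at its two ends.\<close>
  proof
    assume "r' = r \<and> tail r @ w1 \<approx> tail r' @ w2 \<or>
      (\<exists>w1' w2'. tail r @ w1 \<approx> tail r @ w1' \<and> tail_chain r w1' w2' \<and> tail r' @ w2 \<approx> tail r' @ w2')"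
    then show "tail_chain r w1 w2"
      using tail_chain_step[OF complement_refl[OF assms(1)]] tail_chain_step[OF assms(4)] tail_chain_trans
        tail_chain_sym by metis
  qed blast
  also have "\<dots> \<longleftrightarrow> tail rs @ w1 \<approx> tail rs @ w2"
  proof
    assume c: "tail_chain r w1 w2"
    then show "tail rs @ w1 \<approx> tail rs @ w2"
      using tail_chain_cases[OF c] tail_chain_eqv_active[OF c] rs(2) eqv_append by metis
  qed (use tail_chain_step rs in blast)
  finally show ?thesis unfolding agree_def by simp
qed

text \<open>As \<open>r\<close> and \<open>r'\<close> differ, a switch is necessary, and
  \<open>u'\<close> gets \<open>tail r\<close> in front only through an active suffix of
  \<open>tail r\<close>. That active word collapses the chain to a congruence behind
  \<open>tail r\<close>.\<close>

lemma agree_left_not_literal: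
  assumes "r \<in> W" "\<not> unclean r u'" "piece R z" "complement r r'" "complement r r2" "prefix z (stem r2)"
    "r \<noteq> r'" "\<not> prefix (tail r) u'"
  shows "agree (stem r @ u') (stem r' @ tail r' @ w2) z \<longleftrightarrow> agree u' (tail r @ w2) []"
proof -
  have 1: "possible_prefix (tail r) u' \<and> u' \<approx> tail r @ w2" if "stem r @ u' \<approx> stem r' @ tail r' @ w2"
  proof -
    from that[unfolded clean_eqv_iff[OF assms(1,2,4)]] obtain w1 w2' where
      h: "u' \<approx> tail r @ w1" "tail_chain r w1 w2'" "tail r' @ w2 \<approx> tail r' @ w2'" using assms(7) by blast
    then have c: "tail_chain r w1 w2" using tail_chain_step[OF assms(4)] tail_chain_sym tail_chain_trans by blast
    obtain p where "active p w1" "suffix p (tail r)" using not_literal_active[OF assms(1) h(1) assms(8)] by blast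
    then have "tail r @ w1 \<approx> tail r @ w2" using tail_chain_eqv_active[OF c] by blast
    then have "u' \<approx> tail r @ w2" using h(1) eqv_trans by blast
    then show ?thesis unfolding possible_prefix_def by blast
  qed
  have 2: "possible_prefix (tail r) u' \<and> stem r @ u' \<approx> stem r' @ tail r' @ w2" if "u' \<approx> tail r @ w2"
    unfolding clean_eqv_iff[OF assms(1,2,4)] possible_prefix_def using that tail_chain_refl[OF _ assms(1)] by blast
  show ?thesis using agree_switched[OF assms(1-6)] 1 2 by (auto simp: agree_def)
qed

text \<open>The chain is followed backwards; an active suffix of \<open>tail r'\<close> collapses
  it.\<close>

lemma agree_right_not_literal:
  assumes "r \<in> W" "\<not> unclean r (tail r @ w1)" "piece R z" "complement r r'" "complement r r2" "prefix z (stem r2)"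
    "r \<noteq> r'" "\<not> prefix (tail r') v'"
  shows "agree (stem r @ tail r @ w1) (stem r' @ v') z \<longleftrightarrow> agree (tail r' @ w1) v' []"
proof -
  have r'W: "r' \<in> W" using assms(4) complement_W by blast
  have 1: "tail r' @ w1 \<approx> v'" if "stem r @ tail r @ w1 \<approx> stem r' @ v'"
  proof -
    from that[unfolded clean_eqv_iff[OF assms(1,2,4)]] obtain w1' w2 where
      h: "tail r @ w1 \<approx> tail r @ w1'" "tail_chain r w1' w2" "v' \<approx> tail r' @ w2" using assms(7) by blast
    then have c: "tail_chain r w2 w1"
      using tail_chain_step[OF complement_refl[OF assms(1)]] tail_chain_sym tail_chain_trans by blast
    obtain p where "active p w2" "suffix p (tail r')" using not_literal_active[OF r'W h(3) assms(8)] by blast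
    then have "tail r' @ w2 \<approx> tail r' @ w1" using tail_chain_eqv_active[OF c] by blast
    then show ?thesis using h(3) eqv_trans eqv_sym by blast
  qed
  have 2: "stem r @ tail r @ w1 \<approx> stem r' @ v'" if "tail r' @ w1 \<approx> v'"
    unfolding clean_eqv_iff[OF assms(1,2,4)] using eqv_sym[OF that] tail_chain_refl[OF _ assms(1)] by blast
  have "possible_prefix (tail r) (tail r @ w1)" unfolding possible_prefix_def by blast
  then show ?thesis using agree_switched[OF assms(1-6)] 1 2 by (auto simp: agree_def)
qed

lemma longest_common_suffix:
  fixes x y :: "'b list"
  obtains d d' c where "x = d @ c" "y = d' @ c" "\<And>p. suffix p x \<Longrightarrow> suffix p y \<Longrightarrow> suffix p c"
proof -
  let ?c = "ARG_MAX length p. suffix p x \<and> suffix p y"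
  have c: "suffix ?c x \<and> suffix ?c y"
    by (rule arg_max_natI[of _ "[]" length "Suc (length x)"]) (auto simp: less_Suc_eq_le suffix_length_le)
  have len: "length p \<le> length ?c" if "suffix p x \<and> suffix p y" for p
    using that by (rule arg_max_nat_le[of _ _ length "Suc (length x)"]) (auto simp: less_Suc_eq_le suffix_length_le)
  have "suffix p ?c" if "suffix p x" "suffix p y" for p
    using suffix_length_suffix that c len by blast
  moreover obtain d d' where "x = d @ ?c" "y = d' @ ?c" using c unfolding suffix_def by blast
  ultimately show ?thesis using that by blast
qed

text \<open>Both tails come about through active words, which the chain forces to be equal. The
  common active word is a suffix of \<open>c\<close>, so \<open>d\<close> and \<open>d'\<close> must
  be present literally, and \<open>c\<close> becomes the new prefix condition.\<close>

lemma agree_neither_literal: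
  assumes "r \<in> W" "\<not> unclean r u'" "piece R z" "complement r r'" "complement r r2" "prefix z (stem r2)"
    "r \<noteq> r'" "\<not> prefix (tail r) u'" "\<not> prefix (tail r') v'"
    "tail r = d @ c" "tail r' = d' @ c" "\<And>p. suffix p (tail r) \<Longrightarrow> suffix p (tail r') \<Longrightarrow> suffix p c"
  shows "agree (stem r @ u') (stem r' @ v') z \<longleftrightarrow>
    (\<exists>u2 v2. u' = d @ u2 \<and> v' = d' @ v2 \<and> agree u2 v2 c)"
proof -
  have r'W: "r' \<in> W" using assms(4) complement_W by blast
  have 1: "\<exists>u2 v2. u' = d @ u2 \<and> v' = d' @ v2 \<and> agree u2 v2 c" if "stem r @ u' \<approx> stem r' @ v'"
  proof -
    from that[unfolded clean_eqv_iff[OF assms(1,2,4)]] obtain w1 w2 where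
      h: "u' \<approx> tail r @ w1" "tail_chain r w1 w2" "v' \<approx> tail r' @ w2" using assms(7) by blast
    obtain p1 p2 y where p: "tail r = p1 @ p2" "active p2 w1" "p2 @ w1 \<approx> y" "u' = p1 @ y" "suffix p2 (tail r)"
      using not_literal_active[OF assms(1) h(1) assms(8)] by blast
    obtain p1' p2' y' where p': "tail r' = p1' @ p2'" "active p2' w2" "p2' @ w2 \<approx> y'" "v' = p1' @ y'" "suffix p2' (tail r')"
      using not_literal_active[OF r'W h(3) assms(9)] by blast
    have "p2' = p2" using tail_chain_eqv_active(2)[OF h(2) p(2,5)] p'(2) active_unique by blast
    then have "suffix p2 c" using assms(12) p p' by blast
    then obtain e where e: "c = e @ p2" by (auto simp: suffix_def)
    have p1: "p1 = d @ e" "p1' = d' @ e" using p(1) p'(1) assms(10,11) e \<open>p2' = p2\<close> by simp_all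
    have y: "e @ y \<approx> c @ w1" "e @ y' \<approx> c @ w2"
      using eqv_append[OF p(3), of e] eqv_append[OF p'(3), of e] eqv_sym e \<open>p2' = p2\<close> by simp_all
    have "c @ w1 \<approx> c @ w2" using tail_chain_eqv_active(1)[OF h(2) p(2) \<open>suffix p2 c\<close>] .
    then have "e @ y \<approx> e @ y'" using y eqv_trans eqv_sym by blast
    moreover have "possible_prefix c (e @ y)" using y unfolding possible_prefix_def by blast
    moreover have "u' = d @ e @ y" "v' = d' @ e @ y'" using p p' p1 by simp_all
    ultimately show ?thesis unfolding agree_def by blast
  qed
  have 2: "possible_prefix (tail r) u' \<and> stem r @ u' \<approx> stem r' @ v'"
    if h: "u' = d @ u2" "v' = d' @ v2" "agree u2 v2 c" for u2 v2
  proof -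
    obtain w where w: "u2 \<approx> c @ w" "u2 \<approx> v2" using h unfolding agree_def possible_prefix_def by blast
    then have "v2 \<approx> c @ w" using eqv_sym eqv_trans by blast
    then have "u' \<approx> tail r @ w" "v' \<approx> tail r' @ w"
      using w eqv_append[of u2 "c @ w" d] eqv_append[of v2 "c @ w" d'] h assms by simp_all
    then show ?thesis
      unfolding clean_eqv_iff[OF assms(1,2,4)] possible_prefix_def using tail_chain_refl[OF _ assms(1)] by blast
  qed
  have "agree (stem r @ u') (stem r' @ v') z \<Longrightarrow> stem r @ u' \<approx> stem r' @ v'" by (simp add: agree_def)
  then show ?thesis using agree_switched[OF assms(1-6)] 1 2 by blast
qed

text \<open>A tail that does not follow literally provides an active suffix of
  \<open>tail r\<close>, so even a detour through switches gives \<open>u' \<approx> v'\<close>. If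
  \<open>z\<close> does not start \<open>stem r\<close>, a switch must be possible, which is the
  condition \<open>tail r\<close>.\<close>

lemma agree_same_stem:
  assumes "r \<in> W" "\<not> unclean r u'" "piece R z" "complement r r2" "prefix z (stem r2)"
    "\<not> prefix (tail r) u' \<or> \<not> prefix (tail r) v'"
  shows "agree (stem r @ u') (stem r @ v') z \<longleftrightarrow> agree u' v' (if prefix z (stem r) then [] else tail r)"
proof -
  have "stem r @ u' \<approx> stem r @ v' \<longleftrightarrow> u' \<approx> v'"
    unfolding clean_eqv_iff[OF assms(1,2) complement_refl[OF assms(1)]]
  proof
    assume "r = r \<and> u' \<approx> v' \<or> (\<exists>w1 w2. u' \<approx> tail r @ w1 \<and> tail_chain r w1 w2 \<and> v' \<approx> tail r @ w2)"
    then show "u' \<approx> v'"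
    proof (elim disjE exE conjE)
      fix w1 w2 assume h: "u' \<approx> tail r @ w1" "tail_chain r w1 w2" "v' \<approx> tail r @ w2"
      from assms(6) have "tail r @ w1 \<approx> tail r @ w2"
      proof
        assume "\<not> prefix (tail r) u'"
        then show ?thesis using not_literal_active[OF assms(1) h(1)] tail_chain_eqv_active[OF h(2)] by metis
      next
        assume "\<not> prefix (tail r) v'"
        then show ?thesis using not_literal_active[OF assms(1) h(3)]
            tail_chain_eqv_active[OF tail_chain_sym[OF h(2)]] eqv_sym by metis
      qed
      then show ?thesis using h eqv_trans eqv_sym by blast
    qed
  qed blast
  then show ?thesis unfolding agree_def using clean_possible_prefix[OF assms(1-3)] assms(4,5) by auto
qed

section \<open>Bounded look-ahead\<close>

text \<open>The inserted 0 gives \<open>Max\<close> a value when there are no relations.\<close>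

definition max_length :: nat where
  "max_length = Max (insert 0 (length ` W))"

lemma finite_W: "finite W"
  using finite_R by (simp add: relation_words_def)

lemma relation_word_length: "r \<in> W \<Longrightarrow> length r \<le> max_length"
  unfolding max_length_def using finite_W by (intro Max_ge) auto

lemma stem_length: "r \<in> W \<Longrightarrow> length (stem r) \<le> max_length"
  using relation_word_length[of r] by (simp add: stem_def)

lemma piece_sublist: "piece R p \<Longrightarrow> p = [] \<or> (\<exists>r \<in> W. sublist p r)"
  unfolding piece_def by (auto simp: sublist_def)

lemma piece_length: "piece R p \<Longrightarrow> length p \<le> max_length"
  using piece_sublist relation_word_length sublist_length_le by (metis le0 le_trans list.size(3))

text \<open>The next \<open>k\<close> letters of \<open>x @ s\<close> lie in \<open>x\<close>, as far as there are so many.\<close>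

definition sees :: "nat \<Rightarrow> 'a list \<Rightarrow> 'a list \<Rightarrow> bool" where
  "sees k x s \<longleftrightarrow> k \<le> length x \<or> s = []"

lemma sees_mono: "sees k x s \<Longrightarrow> j \<le> k \<Longrightarrow> sees j x s"
  by (auto simp: sees_def)

lemma prefix_sees: "sees k x s \<Longrightarrow> length p \<le> k \<Longrightarrow> prefix p (x @ s) \<longleftrightarrow> prefix p x"
  unfolding sees_def
  using prefix_length_prefix[of p "x @ s" x] by (auto simp: prefix_prefix)

lemma unclean_sees:
  assumes "sees max_length x s"
  shows "unclean r (x @ s) \<longleftrightarrow> unclean r x"
proof -
  have u: "unclean r y \<longleftrightarrow> (\<exists>s h s1 s2. s \<in> W \<and> h \<noteq> [] \<and> s1 \<noteq> [] \<and> stem r = h @ s1 \<and>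
     stem s = s1 @ s2 \<and> prefix s2 y)" for y
    unfolding unclean_def prefix_def by blast
  have "prefix s2 (x @ s) \<longleftrightarrow> prefix s2 x" if "t \<in> W" "stem t = s1 @ s2" for t s1 s2
    using prefix_sees[OF assms, of s2] stem_length[OF that(1)] that(2) by simp
  then show ?thesis unfolding u by blast
qed

lemma candidate_sees:
  assumes "sees max_length x s"
  shows "candidate p (x @ s) \<longleftrightarrow> candidate p x"
proof -
  have "prefix q (x @ s) \<longleftrightarrow> prefix q x" if "p @ q @ e \<in> W" for q e
    using prefix_sees[OF assms, of q] relation_word_length[OF that] by simp
  then show ?thesis unfolding candidate_def by blast
qed

text \<open>Large enough for a stem, a tail and the \<open>max_length\<close> letters on which
  \<open>candidate\<close> and \<open>unclean\<close> depend. It is positive, so an empty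
  \<open>l\<close> with \<open>sees window l s\<close> means that \<open>s\<close> is empty.\<close>

definition window :: nat where
  "window = 4 * max_length + 1"

text \<open>The words compared are \<open>a @ l @ s\<close> and \<open>b @ m @ t\<close>, where \<open>l\<close> and \<open>m\<close> have been read in advance, \<open>s\<close> and \<open>t\<close> are unread,
  and the pieces \<open>a\<close> and \<open>b\<close> replace what was consumed. A consumed letter outweighs any piece, which makes
  the weight a linear bound on the number of reductions.\<close>

definition weight :: "'a list \<Rightarrow> 'a list \<Rightarrow> nat" where
  "weight a l = (max_length + 1) * length l + length a"

text \<open>One verdict serves all unread rests, so it depends on the finite control alone; likewise
  for the single reduction in \<open>reduces\<close>.\<close>

definition decided :: "'a list \<Rightarrow> 'a list \<Rightarrow> 'a list \<Rightarrow> 'a list \<Rightarrow> 'a list \<Rightarrow> bool \<Rightarrow> bool" where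
  "decided a l b m z d \<longleftrightarrow>
     (\<forall>s t. sees window l s \<longrightarrow> sees window m t \<longrightarrow> (agree (a @ l @ s) (b @ m @ t) z \<longleftrightarrow> d))"

definition reduces ::
  "'a list \<Rightarrow> 'a list \<Rightarrow> 'a list \<Rightarrow> 'a list \<Rightarrow> 'a list \<Rightarrow>
   'a list \<Rightarrow> 'a list \<Rightarrow> 'a list \<Rightarrow> 'a list \<Rightarrow> 'a list \<Rightarrow> bool" where
  "reduces a l b m z a' l' b' m' z' \<longleftrightarrow>
     piece R a' \<and> piece R b' \<and> piece R z' \<and> suffix l' l \<and> suffix m' m \<and>
     weight a' l' + weight b' m' < weight a l + weight b m \<and>
     (\<forall>s t. sees window l s \<longrightarrow> sees window m t \<longrightarrow>
        (agree (a @ l @ s) (b @ m @ t) z \<longleftrightarrow> agree (a' @ l' @ s) (b' @ m' @ t) z'))"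

lemma strip_weight:
  assumes "a @ l = c # x" "piece R a"
  obtains a' l' where "x = a' @ l'" "piece R a'" "suffix l' l" "weight a' l' < weight a l"
proof (cases a)
  case Nil
  then show ?thesis using that[of "[]" x] assms by (auto simp: weight_def suffix_def)
next
  case (Cons d a')
  then have "piece R a'" using assms(2) piece_suffix[of "[d]" a'] by simp
  then show ?thesis using that[of a' l] Cons assms by (auto simp: weight_def)
qed

text \<open>A stem is no piece, so removing it from \<open>a @ l\<close> consumes a letter of
  \<open>l\<close>, and this outweighs the new piece \<open>c\<close>.\<close>

lemma stem_weight:
  assumes "a @ l = stem r @ x" "r \<in> W" "piece R a" "suffix y x" "piece R c"
  shows "suffix y l" "weight c y < weight a l"
proof -
  have "\<not> (\<exists>k. a = stem r @ k)" using assms stem_not_piece piece_prefix by blast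
  then obtain k where k: "stem r = a @ k" "l = k @ x" using append_eq_split[OF assms(1)] by blast
  then have "k \<noteq> []" using stem_not_piece[OF assms(2)] assms(3) by auto
  obtain h where h: "x = h @ y" using assms(4) by (auto simp: suffix_def)
  show "suffix y l" using k h by (simp add: suffix_def)
  have "length y < length l" using k h \<open>k \<noteq> []\<close> by (cases k) auto
  then have "(max_length + 1) * (length y + 1) \<le> (max_length + 1) * length l" by (intro mult_le_mono) auto
  then show "weight c y < weight a l" using piece_length[OF assms(5)] unfolding weight_def by (simp add: algebra_simps)
qed

lemma local_reduction_unclean:
  assumes "piece R a" "piece R b" "piece R z"
    "\<And>r x'. r \<in> W \<Longrightarrow> a @ l = stem r @ x' \<Longrightarrow> unclean r x'"
  shows "(\<exists>d. decided a l b m z d) \<or> (\<exists>a' l' b' m' z'. reduces a l b m z a' l' b' m' z')"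
proof (cases "a @ l = [] \<or> b @ m = []")
  case True
  then have "decided a l b m z (a @ l = [] \<and> b @ m = [] \<and> z = [])"
    unfolding decided_def by (auto simp: sees_def window_def agree_Nil)
  then show ?thesis by blast
next
  case False
  then obtain c x e y where x: "a @ l = c # x" and y: "b @ m = e # y" by (meson list.exhaust)
  \<comment> \<open>A stem at the front of the whole word fits into the window, together with the
    letters that decide whether it is clean.\<close>
  have unc: "unclean r u'" if s: "sees window l s" and r: "r \<in> W" "c # (x @ s) = stem r @ u'" for r u' s
  proof -
    have xs: "sees window (a @ l) s" using s by (auto simp: sees_def)
    have "prefix (stem r) ((a @ l) @ s)" using r(2) x by (simp add: prefix_def)
    then have "prefix (stem r) (a @ l)"
      using prefix_sees[OF xs] stem_length[OF r(1)] by (simp add: window_def)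
    then obtain x' where x': "a @ l = stem r @ x'" by (auto simp: prefix_def)
    then have "u' = x' @ s" using r(2) x by (metis append_Cons append.assoc same_append_eq)
    moreover have "sees max_length x' s"
      using xs stem_length[OF r(1)] unfolding x' by (auto simp: sees_def window_def)
    ultimately show ?thesis using assms(4)[OF r(1) x'] unclean_sees by simp
  qed
  have eq: "agree (a @ l @ s) (b @ m @ t) z \<longleftrightarrow> c = e \<and> (z = [] \<or> hd z = c) \<and> agree (x @ s) (y @ t) (tl z)"
    if "sees window l s" for s t
  proof -
    have ab: "a @ l @ s = c # x @ s" "b @ m @ t = e # y @ t" using x y by (metis append_Cons append.assoc)+
    show ?thesis unfolding ab using agree_strip[where a = c and u = "x @ s" and b = e and v = "y @ t" and z = z] unc[OF that]
      by simp
  qed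
  show ?thesis
  proof (cases "c = e \<and> (z = [] \<or> hd z = c)")
    case True
    obtain a' l' where a': "x = a' @ l'" "piece R a'" "suffix l' l" "weight a' l' < weight a l"
      using strip_weight[OF x assms(1)] .
    obtain b' m' where b': "y = b' @ m'" "piece R b'" "suffix m' m" "weight b' m' < weight b m"
      using strip_weight[OF y assms(2)] .
    have "piece R (tl z)" using assms(3) piece_suffix[of "[hd z]" "tl z"] by (cases z) auto
    then have "reduces a l b m z a' l' b' m' (tl z)"
      unfolding reduces_def using a' b' eq True by auto
    then show ?thesis by blast
  next
    case False
    then have "decided a l b m z False" unfolding decided_def using eq by blast
    then show ?thesis by blast
  qed
qed

lemma local_reduction_clean:
  assumes "piece R a" "piece R b" "piece R z" "r \<in> W" "a @ l = stem r @ x" "\<not> unclean r x"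
  shows "(\<exists>d. decided a l b m z d) \<or> (\<exists>a' l' b' m' z'. reduces a l b m z a' l' b' m' z')"
proof -
  \<comment> \<open>The stem takes at most \<open>max_length\<close> letters of the window.\<close>
  have xs: "sees (3 * max_length + 1) x s" if "sees window l s" for s
  proof -
    have "sees window (stem r @ x) s" using that assms(5)[symmetric] by (auto simp: sees_def)
    then show ?thesis using stem_length[OF assms(4)] by (auto simp: sees_def window_def)
  qed
  have nu: "\<not> unclean r (x @ s)" if "sees window l s" for s
    using unclean_sees[OF sees_mono[OF xs[OF that]]] assms(6) by simp
  have u: "a @ l @ s = stem r @ x @ s" for s using assms(5) by (metis append.assoc)
  have nod: ?thesis if "\<And>s t. sees window l s \<Longrightarrow> sees window m t \<Longrightarrow> \<not> agree (stem r @ x @ s) (b @ m @ t) z"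
  proof -
    have "decided a l b m z False" unfolding decided_def u using that by blast
    then show ?thesis by blast
  qed
  show ?thesis
  proof (cases "(\<exists>r2. complement r r2 \<and> prefix z (stem r2)) \<and> (\<exists>r' y. complement r r' \<and> b @ m = stem r' @ y)")
    case False
    show ?thesis
    proof (rule nod)
      fix s t assume s: "sees window l s" and t: "sees window m t"
      show "\<not> agree (stem r @ x @ s) (b @ m @ t) z"
      proof
        assume ag: "agree (stem r @ x @ s) (b @ m @ t) z"
        obtain r' v' where r': "complement r r'" "b @ m @ t = stem r' @ v'"
          using agree_stem_complement(1)[OF assms(4) nu[OF s] assms(3) ag] by blast
        have "sees window (b @ m) t" using t by (auto simp: sees_def)
        moreover have "prefix (stem r') ((b @ m) @ t)" using r'(2) by (simp add: prefix_def)
        ultimately have "prefix (stem r') (b @ m)"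
          using prefix_sees[of window "b @ m" t "stem r'"] stem_length[OF complement_W(2)[OF r'(1)]]
          by (simp add: window_def)
        then show False using False r'(1) agree_stem_complement(2)[OF assms(4) nu[OF s] assms(3) ag]
          by (auto simp: prefix_def)
      qed
    qed
  next
    case True
    then obtain r2 r' y where r2: "complement r r2" "prefix z (stem r2)" and r': "complement r r'" "b @ m = stem r' @ y"
      by blast
    have r'W: "r' \<in> W" using r' complement_W by blast
    have ys: "sees (3 * max_length + 1) y t" if "sees window m t" for t
    proof -
      have "sees window (stem r' @ y) t" using that r'(2)[symmetric] by (auto simp: sees_def)
      then show ?thesis using stem_length[OF r'W] by (auto simp: sees_def window_def)
    qed
    have v: "b @ m @ t = stem r' @ y @ t" for t using r'(2) by (metis append.assoc)
    have px: "prefix p (x @ s) \<longleftrightarrow> prefix p x" if "sees window l s" "length p \<le> max_length" for p s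
      using prefix_sees[OF xs[OF that(1)]] that(2) by simp
    have py: "prefix p (y @ t) \<longleftrightarrow> prefix p y" if "sees window m t" "length p \<le> max_length" for p t
      using prefix_sees[OF ys[OF that(1)]] that(2) by simp
    have tl: "length (tail q) \<le> max_length" for q by (simp add: piece_length)
    have red: ?thesis
      if "suffix x' x" "suffix y' y" "piece R a'" "piece R b'" "piece R z'"
        "\<And>s t. sees window l s \<Longrightarrow> sees window m t \<Longrightarrow>
          agree (stem r @ x @ s) (stem r' @ y @ t) z \<longleftrightarrow> agree (a' @ x' @ s) (b' @ y' @ t) z'"
      for a' x' b' y' z'
    proof -
      have "reduces a l b m z a' x' b' y' z'"
        unfolding reduces_def u v
        using that(3-6) stem_weight[OF assms(5,4,1) that(1,3)] stem_weight[OF r'(2) r'W assms(2) that(2,4)]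
        by (simp add: add_strict_mono)
      then show ?thesis by blast
    qed
    \<comment> \<open>\<open>left\<close> and \<open>right\<close> name the only side on which the
      tail follows literally.\<close>
    consider (both) x' y' where "x = tail r @ x'" "y = tail r' @ y'"
      | (same) "r' = r" "\<not> prefix (tail r) x \<or> \<not> prefix (tail r) y"
      | (right) y' where "r \<noteq> r'" "\<not> prefix (tail r) x" "y = tail r' @ y'"
      | (left) x' where "r \<noteq> r'" "x = tail r @ x'" "\<not> prefix (tail r') y"
      | (neither) "r \<noteq> r'" "\<not> prefix (tail r) x" "\<not> prefix (tail r') y"
      unfolding prefix_def by metis
    then show ?thesis
    proof cases
      case both
      have cand: "candidate p x'" if "sees window l s" "active p (x' @ s)" for p s
      proof -
        have "sees max_length x' s"
          using xs[OF that(1)] tl[of r] unfolding both(1) by (auto simp: sees_def)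
        then show ?thesis using active_candidate[OF that(2)] candidate_sees by blast
      qed
      \<comment> \<open>At most one word is a candidate for \<open>x'\<close>. If it ends the tail
        of some complement, that complement is taken; otherwise \<open>r\<close> serves, the
        condition being vacuous.\<close>
      obtain rs where rs: "complement r rs"
        "\<And>p r1. complement r r1 \<Longrightarrow> suffix p (tail r1) \<Longrightarrow> candidate p x' \<Longrightarrow> suffix p (tail rs)"
      proof (cases "\<exists>p r1. complement r r1 \<and> suffix p (tail r1) \<and> candidate p x'")
        case True
        then obtain p r1 where "complement r r1" "suffix p (tail r1)" "candidate p x'" by blast
        then show ?thesis using that[of r1] candidate_unique by blast
      next
        case False
        then show ?thesis using that[of r] complement_refl[OF assms(4)] by blast
      qed
      show ?thesis
      proof (rule red[of x' y' "tail rs" "tail rs" "[]"])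
        fix s t assume s: "sees window l s" "sees window m t"
        have "\<not> unclean r (tail r @ x' @ s)" using nu[OF s(1)] both(1) by simp
        then show "agree (stem r @ x @ s) (stem r' @ y @ t) z \<longleftrightarrow> agree (tail rs @ x' @ s) (tail rs @ y' @ t) []"
          using agree_both_literal[OF assms(4) _ assms(3) r'(1) r2 rs(1), of "x' @ s" "y' @ t"]
            rs(2) cand[OF s(1)] both by auto
      qed (use both in \<open>simp_all add: suffix_def\<close>)
    next
      case same
      show ?thesis
      proof (rule red[of x y "[]" "[]" "if prefix z (stem r) then [] else tail r"])
        fix s t assume s: "sees window l s" "sees window m t"
        show "agree (stem r @ x @ s) (stem r' @ y @ t) z \<longleftrightarrow>
          agree ([] @ x @ s) ([] @ y @ t) (if prefix z (stem r) then [] else tail r)"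
          using agree_same_stem[OF assms(4) nu[OF s(1)] assms(3) r2, of "y @ t"]
            px[OF s(1) tl] py[OF s(2) tl] same by simp
      qed simp_all
    next
      case right
      show ?thesis
      proof (rule red[of x y' "[]" "tail r" "[]"])
        fix s t assume s: "sees window l s" "sees window m t"
        show "agree (stem r @ x @ s) (stem r' @ y @ t) z \<longleftrightarrow> agree ([] @ x @ s) (tail r @ y' @ t) []"
          using agree_left_not_literal[OF assms(4) nu[OF s(1)] assms(3) r'(1) r2 right(1), of "y' @ t"]
            px[OF s(1) tl] right by simp
      qed (use right in \<open>simp_all add: suffix_def\<close>)
    next
      case left
      show ?thesis
      proof (rule red[of x' y "tail r'" "[]" "[]"])
        fix s t assume s: "sees window l s" "sees window m t"
        have "\<not> unclean r (tail r @ x' @ s)" using nu[OF s(1)] left(2) by simp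
        then show "agree (stem r @ x @ s) (stem r' @ y @ t) z \<longleftrightarrow> agree (tail r' @ x' @ s) ([] @ y @ t) []"
          using agree_right_not_literal[OF assms(4) _ assms(3) r'(1) r2 left(1), of "x' @ s" "y @ t"]
            py[OF s(2) tl] left by simp
      qed (use left in \<open>simp_all add: suffix_def\<close>)
    next
      case neither
      obtain d d' c where c: "tail r = d @ c" "tail r' = d' @ c"
        "\<And>p. suffix p (tail r) \<Longrightarrow> suffix p (tail r') \<Longrightarrow> suffix p c"
        using longest_common_suffix[of "tail r" "tail r'"] by metis
      have eq: "agree (stem r @ x @ s) (stem r' @ y @ t) z \<longleftrightarrow>
          (\<exists>u2 v2. x @ s = d @ u2 \<and> y @ t = d' @ v2 \<and> agree u2 v2 c)"
        if s: "sees window l s" "sees window m t" for s t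
        using agree_neither_literal[OF assms(4) nu[OF s(1)] assms(3) r'(1) r2 neither(1) _ _ c, of "y @ t"]
          px[OF s(1) tl] py[OF s(2) tl] neither by simp
      \<comment> \<open>So the window shows whether \<open>d\<close> and \<open>d'\<close> are
        present; if not, the answer is negative.\<close>
      have dl: "length d \<le> max_length" "length d' \<le> max_length" using tl[of r] tl[of r'] c by simp_all
      show ?thesis
      proof (cases "prefix d x \<and> prefix d' y")
        case True
        then obtain x' y' where x': "x = d @ x'" "y = d' @ y'" by (auto simp: prefix_def)
        show ?thesis
        proof (rule red[of x' y' "[]" "[]" c])
          fix s t assume s: "sees window l s" "sees window m t"
          show "agree (stem r @ x @ s) (stem r' @ y @ t) z \<longleftrightarrow> agree ([] @ x' @ s) ([] @ y' @ t) c"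
            unfolding eq[OF s] using x' by simp
        next
          show "piece R c" using piece_suffix[of d c] c(1) piece_tail[of r] by simp
        qed (use x' in \<open>simp_all add: suffix_def\<close>)
      next
        case False
        show ?thesis
        proof (rule nod)
          fix s t assume s: "sees window l s" "sees window m t"
          show "\<not> agree (stem r @ x @ s) (b @ m @ t) z"
            unfolding v eq[OF s] using px[OF s(1) dl(1)] py[OF s(2) dl(2)] False by (auto simp: prefix_def)
        qed
      qed
    qed
  qed
qed

lemma local_reduction:
  assumes "piece R a" "piece R b" "piece R z"
  shows "(\<exists>d. decided a l b m z d) \<or> (\<exists>a' l' b' m' z'. reduces a l b m z a' l' b' m' z')"
  using local_reduction_unclean[OF assms] local_reduction_clean[OF assms] by blast

end

section \<open>Two-head one-way readers\<close>

definition peek :: "'a list \<Rightarrow> 'a option" where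
  "peek s = (if s = [] then None else Some (hd s))"

text \<open>One head on each word; the booleans tell which heads advance. A verdict
  \<open>Inr d\<close> is a fixed point, like the halting configurations of a machine.\<close>

fun read_step ::
  "('c \<Rightarrow> 'a option \<Rightarrow> 'a option \<Rightarrow> ('c \<times> bool \<times> bool) + bool) \<Rightarrow>
   ('c \<times> 'a list \<times> 'a list) + bool \<Rightarrow> ('c \<times> 'a list \<times> 'a list) + bool" where
  "read_step \<delta> (Inl (c, s, t)) =
     (case \<delta> c (peek s) (peek t) of
        Inl (c', i, j) \<Rightarrow> Inl (c', if i then tl s else s, if j then tl t else t)
      | Inr d \<Rightarrow> Inr d)"
| "read_step \<delta> (Inr d) = Inr d"

text \<open>\<open>Separator\<close> and blank both count as the end of a word: the first tape keeps
  the whole input, and \<open>Separator\<close> ends \<open>u\<close> on it.\<close>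

fun letter :: "'a tape_symbol \<Rightarrow> 'a option" where
  "letter (Letter x) = Some x"
| "letter _ = None"

locale two_head_reader =
  fixes A :: "'a set" and Q :: "'c set"
    and \<delta> :: "'c \<Rightarrow> 'a option \<Rightarrow> 'a option \<Rightarrow> ('c \<times> bool \<times> bool) + bool"
    and c0 :: 'c and enc :: "'c \<Rightarrow> nat"
  assumes finite_A: "finite A" and finite_Q: "finite Q" and c0: "c0 \<in> Q" and inj_enc: "inj_on enc Q"
    and closed: "\<And>c x y c' i j. c \<in> Q \<Longrightarrow> set_option x \<subseteq> A \<Longrightarrow> set_option y \<subseteq> A \<Longrightarrow>
      \<delta> c x y = Inl (c', i, j) \<Longrightarrow> c' \<in> Q"
begin

text \<open>The offset reserves the numbers 0 to 5 for halting and preparation.\<close>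

definition code :: "'c \<Rightarrow> nat" where
  "code c = enc c + 6"

definition decode :: "nat \<Rightarrow> 'c" where
  "decode = inv_into Q code"

lemma decode_code: "c \<in> Q \<Longrightarrow> decode (code c) = c"
  unfolding decode_def by (rule inv_into_f_f) (use inj_enc in \<open>auto simp: inj_on_def code_def\<close>)

lemma code_ge: "6 \<le> code c"
  by (simp add: code_def)

text \<open>State 2 looks for the separator, 3 copies the second word to the second tape, 4 and 5 rewind
  the second and the first tape; 0 and 1 are the halting states.\<close>

definition transition :: "nat \<Rightarrow> 'a tape_symbol \<Rightarrow> 'a tape_symbol \<Rightarrow>
    nat \<times> ('a tape_symbol \<times> direction) \<times> ('a tape_symbol \<times> direction)" where
  "transition q a b =
    (if q = 2 then (if a = Separator then 3 else 2, (a, Right), (b, Stay))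
     else if q = 3 then
       (if letter a = None then (4, (a, Left), (b, Left)) else (3, (a, Right), (a, Right)))
     else if q = 4 then
       (if letter b = None then (5, (a, Stay), (b, Right)) else (4, (a, Stay), (b, Left)))
     else if q = 5 then
       (if a = Work 0 then (code c0, (a, Right), (b, Stay)) else (5, (a, Left), (b, Stay)))
     else (case \<delta> (decode q) (letter a) (letter b) of
         Inr d \<Rightarrow> (if d then 0 else 1, (a, Stay), (b, Stay))
       | Inl (c', i, j) \<Rightarrow> (code c', (a, if i \<and> letter a \<noteq> None then Right else Stay),
                                    (b, if j \<and> letter b \<noteq> None then Right else Stay))))"

definition machine :: "(nat, 'a tape_symbol) tm2" where
  "machine = \<lparr>states = {..<6} \<union> code ` Q, symbols = insert (Work 0) (input_symbols A),
     blank = Work 0, start = 2, accept = 0, reject = 1, delta = transition\<rparr>"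

lemma machine_simps [simp]:
  "blank machine = Work 0" "start machine = 2" "accept machine = 0" "reject machine = 1"
  "delta machine = transition"
  by (simp_all add: machine_def)

lemma wf_machine: "wf_tm2 (input_symbols A) machine"
proof -
  let ?S = "insert (Work 0) (input_symbols A)" and ?Q = "{..<6} \<union> code ` Q"
  have "transition q a b \<in> ?Q \<times> (?S \<times> UNIV) \<times> (?S \<times> UNIV)"
    if q: "q \<in> ?Q - {0, 1}" and a: "a \<in> ?S" and b: "b \<in> ?S" for q a b
  proof (cases "q \<in> {2, 3, 4, 5}")
    case True
    then show ?thesis using a b c0 unfolding transition_def by (elim insertE) auto
  next
    case False
    have "q \<in> code ` Q"
    proof (rule ccontr)
      assume "q \<notin> code ` Q"
      then have "q < 6" using q by auto
      then show False using q False by auto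
    qed
    then obtain c where c: "c \<in> Q" "q = code c" by blast
    have l: "set_option (letter x) \<subseteq> A" if "x \<in> ?S" for x
      using that by (auto simp: input_symbols_def)
    show ?thesis
    proof (cases "\<delta> c (letter a) (letter b)")
      case (Inl e)
      obtain c' i j where e: "e = (c', i, j)" by (cases e)
      have "c' \<in> Q" using closed[OF c(1) l[OF a] l[OF b]] Inl e by blast
      then show ?thesis using False a b Inl e c decode_code unfolding transition_def by auto
    next
      case (Inr d)
      then show ?thesis using False a b c decode_code unfolding transition_def by auto
    qed
  qed
  moreover have "finite (input_symbols A)" using finite_A by (simp add: input_symbols_def)
  moreover have "Work 0 \<notin> input_symbols A" by (auto simp: input_symbols_def)
  ultimately show ?thesis using finite_Q unfolding wf_tm2_def machine_def by auto
qed

section \<open>Preparing the tapes and simulating the reader\<close>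

context
  fixes u v :: "'a list"
begin

definition input_cells :: "int \<Rightarrow> 'a tape_symbol" where
  "input_cells = fst (tape_of (Work 0) (encode_pair u v))"

definition copied_cells :: "nat \<Rightarrow> int \<Rightarrow> 'a tape_symbol" where
  "copied_cells k = (\<lambda>i. if 0 \<le> i \<and> i < int k then Letter (v ! nat i) else Work 0)"

lemma input_cells_simps:
  "i < length u \<Longrightarrow> input_cells (int i) = Letter (u ! i)"
  "input_cells (int (length u)) = Separator"
  "k < length v \<Longrightarrow> input_cells (int (length u + 1 + k)) = Letter (v ! k)"
  "input_cells (int (length u + 1 + length v)) = Work 0"
  "input_cells (- 1) = Work 0"
  by (simp_all add: input_cells_def tape_of_def encode_pair_def nth_append nat_add_distrib)

lemma copied_cells_simps:
  "i < k \<Longrightarrow> copied_cells k (int i) = Letter (v ! i)"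
  "copied_cells k (int k) = Work 0"
  "copied_cells k (- 1) = Work 0"
  "(copied_cells k)(int k := Letter (v ! k)) = copied_cells (Suc k)"
  by (auto simp: copied_cells_def fun_eq_iff)

lemma initial: "initial_config machine (encode_pair u v) = (2, (input_cells, 0), (copied_cells 0, 0))"
  by (auto simp: initial_config_def input_cells_def copied_cells_def tape_of_def fun_eq_iff)

abbreviation reach :: "nat \<Rightarrow> (nat, 'a tape_symbol) config \<Rightarrow> (nat, 'a tape_symbol) config \<Rightarrow> bool" where
  "reach n c d \<equiv> (step machine ^^ n) c = d"

lemma reach_trans: "reach m c d \<Longrightarrow> reach n d e \<Longrightarrow> reach (n + m) c e"
  by (auto simp: funpow_add)

lemma reach_Suc: "reach m c d \<Longrightarrow> step machine d = e \<Longrightarrow> reach (Suc m) c e"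
  by simp

lemma scan: "j \<le> length u \<Longrightarrow>
  reach j (2, (input_cells, 0), (copied_cells 0, 0)) (2, (input_cells, int j), (copied_cells 0, 0))"
proof (induction j)
  case (Suc j)
  then have "step machine (2, (input_cells, int j), (copied_cells 0, 0)) =
    (2, (input_cells, int (Suc j)), (copied_cells 0, 0))"
    by (simp add: transition_def input_cells_simps fun_upd_idem)
  then show ?case using Suc by (intro reach_Suc) auto
qed simp

lemma separator: "step machine (2, (input_cells, int (length u)), (copied_cells 0, 0)) =
    (3, (input_cells, int (length u + 1)), (copied_cells 0, int 0))"
  by (simp add: transition_def input_cells_simps fun_upd_idem)

lemma copy: "j \<le> length v \<Longrightarrow>
  reach j (3, (input_cells, int (length u + 1)), (copied_cells 0, int 0))
    (3, (input_cells, int (length u + 1 + j)), (copied_cells j, int j))"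
proof (induction j)
  case (Suc j)
  have "input_cells (int (length u + 1 + j)) = Letter (v ! j)"
    using Suc.prems input_cells_simps(3)[of j] by simp
  then have "step machine (3, (input_cells, int (length u + 1 + j)), (copied_cells j, int j)) =
    (3, (input_cells, int (length u + 1 + Suc j)), (copied_cells (Suc j), int (Suc j)))"
    using copied_cells_simps(4)[of j] by (simp add: transition_def fun_upd_idem algebra_simps)
  then show ?case using Suc by (intro reach_Suc) auto
qed simp

lemma end_of_input:
  "step machine (3, (input_cells, int (length u + 1 + length v)), (copied_cells (length v), int (length v))) =
    (4, (input_cells, int (length u + length v)), (copied_cells (length v), int (length v) - 1))"
  using input_cells_simps(4) copied_cells_simps(2)[of "length v"]
  by (simp add: transition_def fun_upd_idem algebra_simps)

lemma rewind_copy: "j \<le> length v \<Longrightarrow>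
  reach j (4, (input_cells, h), (copied_cells (length v), int (length v) - 1))
    (4, (input_cells, h), (copied_cells (length v), int (length v - j) - 1))"
proof (induction j)
  case (Suc j)
  have i: "int (length v - j) - 1 = int (length v - Suc j)" using Suc.prems by simp
  have "copied_cells (length v) (int (length v - Suc j)) = Letter (v ! (length v - Suc j))"
    by (rule copied_cells_simps(1)) (use Suc.prems in simp)
  then have "step machine (4, (input_cells, h), (copied_cells (length v), int (length v - j) - 1)) =
    (4, (input_cells, h), (copied_cells (length v), int (length v - Suc j) - 1))"
    unfolding i by (simp add: transition_def fun_upd_idem)
  then show ?case using Suc by (intro reach_Suc) auto
qed simp

lemma copy_rewound:
  "step machine (4, (input_cells, h), (copied_cells (length v), - 1)) =
    (5, (input_cells, h), (copied_cells (length v), 0))"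
  by (simp add: transition_def copied_cells_simps fun_upd_idem)

lemma rewind_input: "j \<le> length u + length v + 1 \<Longrightarrow>
  reach j (5, (input_cells, int (length u + length v)), (copied_cells (length v), 0))
    (5, (input_cells, int (length u + length v + 1 - j) - 1), (copied_cells (length v), 0))"
proof (induction j)
  case (Suc j)
  let ?i = "length u + length v + 1 - Suc j"
  have i: "int (length u + length v + 1 - j) - 1 = int ?i" using Suc.prems by simp
  have "input_cells (int ?i) \<noteq> Work 0"
  proof -
    consider "?i < length u" | "?i = length u" | k where "k < length v" "?i = length u + 1 + k"
    proof -
      have "?i < length u + 1 + length v" using Suc.prems by simp
      then show thesis using that(1,2) that(3)[of "?i - (length u + 1)"] by linarith
    qed
    then show ?thesis
    proof cases
      case (3 k) then show ?thesis using input_cells_simps(3)[of k] by (simp only:) simp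
    qed (simp_all only: input_cells_simps tape_symbol.distinct not_False_eq_True)
  qed
  then have "step machine (5, (input_cells, int (length u + length v + 1 - j) - 1), (copied_cells (length v), 0)) =
    (5, (input_cells, int ?i - 1), (copied_cells (length v), 0))"
    unfolding i by (simp add: transition_def fun_upd_idem)
  then show ?case using Suc by (intro reach_Suc) auto
qed simp

lemma input_rewound:
  "step machine (5, (input_cells, - 1), (copied_cells (length v), 0)) =
    (code c0, (input_cells, 0), (copied_cells (length v), 0))"
  by (simp add: transition_def input_cells_simps fun_upd_idem)

lemma preparation:
  "\<exists>n \<le> 5 * (length u + length v + 1). reach n (initial_config machine (encode_pair u v))
     (code c0, (input_cells, int 0), (copied_cells (length v), int 0))"
proof -
  note reach_Suc[OF scan[OF order_refl] separator]
  note reach_Suc[OF reach_trans[OF this copy[OF order_refl]] end_of_input]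
  note reach_trans[OF this rewind_copy[OF order_refl]]
  then have "reach (length v + Suc (length v + Suc (length u))) (2, (input_cells, 0), (copied_cells 0, 0))
    (4, (input_cells, int (length u + length v)), (copied_cells (length v), - 1))" by simp
  note reach_trans[OF reach_Suc[OF this copy_rewound] rewind_input[OF order_refl]]
  then have "reach (length u + length v + 1 + Suc (length v + Suc (length v + Suc (length u))))
    (2, (input_cells, 0), (copied_cells 0, 0)) (5, (input_cells, - 1), (copied_cells (length v), 0))" by simp
  note reach_Suc[OF this input_rewound]
  \<comment> \<open>The phases take \<open>2 * length u + 3 * length v + 5\<close> steps
    altogether.\<close>
  then show ?thesis unfolding initial
    by (intro exI[of _ "Suc (length u + length v + 1 + Suc (length v + Suc (length v + Suc (length u))))"]) simp
qed

text \<open>After the preparation the tape contents no longer change, so the head positions alone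
  determine the unread words.\<close>

inductive simulates ::
  "('c \<times> 'a list \<times> 'a list) + bool \<Rightarrow> (nat, 'a tape_symbol) config \<Rightarrow> bool" where
  running: "c \<in> Q \<Longrightarrow> i \<le> length u \<Longrightarrow> j \<le> length v \<Longrightarrow>
    simulates (Inl (c, drop i u, drop j v)) (code c, (input_cells, int i), (copied_cells (length v), int j))"
| halted: "simulates (Inr d) (if d then 0 else 1, S, T)"

lemma letter_cells:
  "i \<le> length u \<Longrightarrow> letter (input_cells (int i)) = peek (drop i u)"
  "j \<le> length v \<Longrightarrow> letter (copied_cells (length v) (int j)) = peek (drop j v)"
  using input_cells_simps(1,2) copied_cells_simps(1,2)
  by (auto simp: peek_def hd_drop_conv_nth le_less)

lemma simulates_step:
  assumes "simulates x y" "u \<in> lists A" "v \<in> lists A"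
  shows "simulates (read_step \<delta> x) (step machine y)"
  using assms(1)
proof cases
  case (running c i j)
  let ?a = "input_cells (int i)" and ?b = "copied_cells (length v) (int j)"
  have le: "set_option (letter ?a) \<subseteq> A" "set_option (letter ?b) \<subseteq> A"
    using assms(2,3) running by (auto simp: letter_cells peek_def hd_drop_conv_nth)
  note l = letter_cells(1)[OF running(4)] letter_cells(2)[OF running(5)]
  have code: "code c \<noteq> 0" "code c \<noteq> 1" "code c \<noteq> 2" "code c \<noteq> 3" "code c \<noteq> 4" "code c \<noteq> 5"
    using code_ge[of c] by auto
  show ?thesis
  proof (cases "\<delta> c (letter ?a) (letter ?b)")
    case (Inl e)
    obtain c' p q where e: "e = (c', p, q)" by (cases e)
    have c': "c' \<in> Q" using closed[OF running(3) le] Inl e by blast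
    \<comment> \<open>A head told to advance at the end of its word stays, matching
      \<open>tl [] = []\<close>.\<close>
    let ?i = "if p \<and> letter ?a \<noteq> None then Suc i else i" and ?j = "if q \<and> letter ?b \<noteq> None then Suc j else j"
    have "step machine y = (code c', (input_cells, int ?i), (copied_cells (length v), int ?j))"
      using running code Inl e decode_code[OF running(3)] by (auto simp: transition_def fun_upd_idem)
    moreover have "read_step \<delta> x = Inl (c', drop ?i u, drop ?j v)"
      using running Inl e l by (auto simp: peek_def tl_drop drop_Suc)
    moreover have "?i \<le> length u" "?j \<le> length v"
      using running l by (auto simp: peek_def)
    ultimately show ?thesis using simulates.running[OF c'] by simp
  next
    case (Inr d)
    have "step machine y = (if d then 0 else 1, (input_cells, int i), (copied_cells (length v), int j))"
      using running code Inr decode_code[OF running(3)] by (auto simp: transition_def fun_upd_idem)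
    moreover have "read_step \<delta> x = Inr d" using running Inr l by simp
    ultimately show ?thesis using simulates.halted by simp
  qed
next
  case (halted d S T)
  then have "step machine y = y" by (cases S; cases T) auto
  then show ?thesis using halted simulates.halted by simp
qed

lemma machine_simulates:
  assumes "u \<in> lists A" "v \<in> lists A" "(read_step \<delta> ^^ n) (Inl (c0, u, v)) = Inr d"
  shows "\<exists>t \<le> 5 * (length u + length v + 1) + n.
    state_after machine (encode_pair u v) t = (if d then accept machine else reject machine)"
proof -
  obtain m where m: "m \<le> 5 * (length u + length v + 1)" "reach m (initial_config machine (encode_pair u v))
     (code c0, (input_cells, int 0), (copied_cells (length v), int 0))" (is "reach m _ ?c")
    using preparation by blast
  have "simulates ((read_step \<delta> ^^ k) (Inl (c0, u, v))) ((step machine ^^ k) ?c)" for k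
  proof (induction k)
    case 0
    then show ?case using running[OF c0, of 0 0] by simp
  next
    case (Suc k)
    then show ?case using simulates_step[OF Suc assms(1,2)] by simp
  qed
  then have "simulates (Inr d) ((step machine ^^ n) ?c)" using assms(3) by metis
  then have "fst ((step machine ^^ n) ?c) = (if d then 0 else 1)" by cases auto
  moreover have "(step machine ^^ (n + m)) (initial_config machine (encode_pair u v)) = (step machine ^^ n) ?c"
    using m(2) by (simp only: funpow_add o_apply)
  ultimately have "state_after machine (encode_pair u v) (n + m) = (if d then accept machine else reject machine)"
    by (simp add: state_after_def)
  then show ?thesis using m(1) by (intro exI[of _ "n + m"]) simp
qed

end

end

lemma reader_machine:
  fixes A :: "'a set" and Q :: "'c set" and \<delta> :: "'c \<Rightarrow> 'a option \<Rightarrow> 'a option \<Rightarrow> ('c \<times> bool \<times> bool) + bool"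
  assumes "finite A" "finite Q" "c0 \<in> Q"
    and "\<And>c x y c' i j. c \<in> Q \<Longrightarrow> set_option x \<subseteq> A \<Longrightarrow> set_option y \<subseteq> A \<Longrightarrow>
      \<delta> c x y = Inl (c', i, j) \<Longrightarrow> c' \<in> Q"
    and run: "\<And>u v. u \<in> lists A \<Longrightarrow> v \<in> lists A \<Longrightarrow>
      \<exists>n \<le> k * (length u + length v + 1). (read_step \<delta> ^^ n) (Inl (c0, u, v)) = Inr (same_element A R u v)"
  shows "\<exists>M :: (nat, 'a tape_symbol) tm2.
           wf_tm2 (input_symbols A) M \<and> solves_word_problem_in_linear_time M A R"
proof -
  obtain enc :: "'c \<Rightarrow> nat" where "inj_on enc Q" using finite_imp_inj_to_nat_seg[OF assms(2)] by metis
  then interpret two_head_reader A Q \<delta> c0 enc using assms by unfold_locales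
  have "\<exists>t \<le> (5 + k) * (length u + length v + 1). state_after machine (encode_pair u v) t =
      (if same_element A R u v then accept machine else reject machine)"
    if u: "u \<in> lists A" "v \<in> lists A" for u v
  proof -
    obtain n where n: "n \<le> k * (length u + length v + 1)"
      "(read_step \<delta> ^^ n) (Inl (c0, u, v)) = Inr (same_element A R u v)" using run[OF u] by blast
    obtain t where "t \<le> 5 * (length u + length v + 1) + n" "state_after machine (encode_pair u v) t =
      (if same_element A R u v then accept machine else reject machine)"
      using machine_simulates[OF u n(2)] by blast
    then show ?thesis using n(1) by (intro exI[of _ t]) (simp add: algebra_simps)
  qed
  then have "solves_word_problem_in_linear_time machine A R"
    unfolding solves_word_problem_in_linear_time_def by blast
  then show ?thesis using wf_machine by blast
qed

section \<open>Solving the word problem\<close>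

type_synonym 'a control = "'a list \<times> 'a list \<times> 'a list \<times> 'a list \<times> 'a list"

context weakly_C4
begin

definition valid_outcome :: "'a control \<Rightarrow> 'a control + bool \<Rightarrow> bool" where
  "valid_outcome = (\<lambda>(a, l, b, m, z) e.
     case e of Inl (a', l', b', m', z') \<Rightarrow> reduces a l b m z a' l' b' m' z' | Inr d \<Rightarrow> decided a l b m z d)"

text \<open>The choice depends on the control only. Finitely many controls occur, so the chosen
  outcomes form a finite table inside the machine.\<close>

definition outcome :: "'a control \<Rightarrow> 'a control + bool" where
  "outcome c = (SOME e. valid_outcome c e)"

lemma outcome:
  assumes "piece R a" "piece R b" "piece R z"
  shows "valid_outcome (a, l, b, m, z) (outcome (a, l, b, m, z))"
proof -
  consider d where "decided a l b m z d" | a' l' b' m' z' where "reduces a l b m z a' l' b' m' z'"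
    using local_reduction[OF assms] by blast
  then have "\<exists>e. valid_outcome (a, l, b, m, z) e"
  proof cases
    case (1 d)
    then show ?thesis by (intro exI[of _ "Inr d"]) (simp add: valid_outcome_def)
  next
    case (2 a' l' b' m' z')
    then show ?thesis by (intro exI[of _ "Inl (a', l', b', m', z')"]) (simp add: valid_outcome_def)
  qed
  then show ?thesis unfolding outcome_def by (rule someI_ex)
qed

text \<open>Reductions are made only when each window is full or its word exhausted, which is what
  \<open>sees\<close> demands.\<close>

definition reader :: "'a control \<Rightarrow> 'a option \<Rightarrow> 'a option \<Rightarrow> ('a control \<times> bool \<times> bool) + bool" where
  "reader = (\<lambda>(a, l, b, m, z) x y.
     if length l < window \<and> x \<noteq> None then Inl ((a, l @ [the x], b, m, z), True, False)
     else if length m < window \<and> y \<noteq> None then Inl ((a, l, b, m @ [the y], z), False, True)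
     else case outcome (a, l, b, m, z) of Inl c \<Rightarrow> Inl (c, False, False) | Inr d \<Rightarrow> Inr d)"

text \<open>An unread letter counts \<open>max_length + 2\<close> and a letter in the window
  \<open>max_length + 1\<close>, so reading lowers the measure just as a reduction does. The last
  summand 1 is the step that gives the verdict.\<close>

lemma reader_decides:
  assumes "piece R a" "piece R b" "piece R z"
  shows "\<exists>n \<le> weight a l + weight b m + (max_length + 2) * (length s + length t) + 1.
    (read_step reader ^^ n) (Inl ((a, l, b, m, z), s, t)) = Inr (agree (a @ l @ s) (b @ m @ t) z)"
  using assms
proof (induction "weight a l + weight b m + (max_length + 2) * (length s + length t)"
    arbitrary: a l b m z s t rule: less_induct)
  case less
  let ?N = "\<lambda>a l b m s t. weight a l + weight b m + (max_length + 2) * (length s + length t)"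
  let ?x = "Inl ((a, l, b, m, z), s, t)"
  have continue: ?case
    if h: "read_step reader ?x = Inl ((a', l', b', m', z'), s', t')" "piece R a'" "piece R b'" "piece R z'"
      "?N a' l' b' m' s' t' < ?N a l b m s t"
      "agree (a' @ l' @ s') (b' @ m' @ t') z' \<longleftrightarrow> agree (a @ l @ s) (b @ m @ t) z"
    for a' l' b' m' z' s' t'
  proof -
    obtain n where n: "n \<le> ?N a' l' b' m' s' t' + 1"
      "(read_step reader ^^ n) (Inl ((a', l', b', m', z'), s', t')) = Inr (agree (a' @ l' @ s') (b' @ m' @ t') z')"
      using less.hyps[OF h(5,2,3,4)] by blast
    then have "(read_step reader ^^ Suc n) ?x = Inr (agree (a @ l @ s) (b @ m @ t) z)"
      using h(1,6) by (simp add: funpow_Suc_right del: funpow.simps)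
    then show ?thesis using n(1) h(5) by (intro exI[of _ "Suc n"]) simp
  qed
  consider (left) x s' where "length l < window" "s = x # s'"
    | (right) y t' where "\<not> (length l < window \<and> s \<noteq> [])" "length m < window" "t = y # t'"
    | (full) "\<not> (length l < window \<and> s \<noteq> [])" "\<not> (length m < window \<and> t \<noteq> [])"
    by (cases s; cases t) auto
  then show ?case
  proof cases
    case left
    show ?thesis
      by (rule continue[of a "l @ [x]" b m z s' t]) (use left less.prems in \<open>simp_all add: reader_def peek_def weight_def\<close>)
  next
    case right
    show ?thesis
      by (rule continue[of a l b "m @ [y]" z s t']) (use right less.prems in \<open>simp_all add: reader_def peek_def weight_def\<close>)
  next
    case full
    then have sees: "sees window l s" "sees window m t" by (auto simp: sees_def)
    have step: "read_step reader ?x =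
        (case outcome (a, l, b, m, z) of Inl c \<Rightarrow> Inl (c, s, t) | Inr d \<Rightarrow> Inr d)"
      using full by (auto simp: reader_def peek_def split: sum.split)
    show ?thesis
    proof (cases "outcome (a, l, b, m, z)")
      case (Inl c)
      obtain a' l' b' m' z' where c: "c = (a', l', b', m', z')" by (cases c)
      then have "reduces a l b m z a' l' b' m' z'"
        using outcome[OF less.prems, of l m] Inl by (simp add: valid_outcome_def)
      then show ?thesis using continue[of a' l' b' m' z' s t] step Inl c sees unfolding reduces_def by simp
    next
      case (Inr d)
      then have "decided a l b m z d" using outcome[OF less.prems, of l m] by (simp add: valid_outcome_def)
      then have "(read_step reader ^^ 1) ?x = Inr (agree (a @ l @ s) (b @ m @ t) z)"
        using step Inr sees unfolding decided_def by simp
      then show ?thesis by (metis le_add2)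
    qed
  qed
qed

definition controls :: "'a set \<Rightarrow> 'a control set" where
  "controls A = {p. piece R p} \<times> {l \<in> lists A. length l \<le> window} \<times> {p. piece R p} \<times>
     {l \<in> lists A. length l \<le> window} \<times> {p. piece R p}"

lemma finite_controls:
  assumes "finite A"
  shows "finite (controls A)"
proof -
  have "{p. piece R p} \<subseteq> insert [] (\<Union>r \<in> W. set (sublists r))"
    using piece_sublist by fastforce
  then have "finite {p. piece R p}" by (rule finite_subset) (simp add: finite_W)
  moreover have "finite {l \<in> lists A. length l \<le> window}"
    using finite_lists_length_le[OF assms, of window] by (simp add: lists_eq_set)
  ultimately show ?thesis unfolding controls_def by simp
qed

lemma controls_closed:
  assumes "c \<in> controls A" "set_option x \<subseteq> A" "set_option y \<subseteq> A" "reader c x y = Inl (c', i, j)"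
  shows "c' \<in> controls A"
proof -
  obtain a l b m z where c: "c = (a, l, b, m, z)" by (cases c)
  show ?thesis
  proof (cases "length l < window \<and> x \<noteq> None \<or> length m < window \<and> y \<noteq> None")
    case True
    then show ?thesis using assms by (auto simp: c controls_def reader_def split: if_splits)
  next
    case False
    then have o: "outcome c = Inl c'" using assms(4) by (auto simp: c reader_def split: sum.splits if_splits)
    obtain a' l' b' m' z' where c': "c' = (a', l', b', m', z')" by (cases c')
    have "reduces a l b m z a' l' b' m' z'"
      using outcome[of a b z l m] assms(1) o by (simp add: c c' controls_def valid_outcome_def)
    then have "piece R a'" "piece R b'" "piece R z'" "suffix l' l" "suffix m' m" by (simp_all add: reduces_def)
    moreover have "set l' \<subseteq> set l" "length l' \<le> length l" "set m' \<subseteq> set m" "length m' \<le> length m"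
      using \<open>suffix l' l\<close> \<open>suffix m' m\<close> by (auto simp: set_mono_suffix suffix_length_le dest: set_mono_suffix)
    ultimately show ?thesis using assms(1) by (auto simp: c c' controls_def)
  qed
qed

section \<open>The congruence of the presentation as rewriting\<close>

lemma same_element_eqv:
  assumes "same_element A R u v"
  shows "u \<approx> v"
  using assms
proof induction
  case (rel u v)
  then have "complement u v" by (auto simp: complement_def relation_words_def image_iff intro: bexI[of _ "(u, v)"])
  then show ?case using complement_eqv[of u v "[]"] by simp
next
  case (mult u u' v v')
  then show ?case using eqv_context[of u u' "[]" v] eqv_append[of v v' u'] eqv_trans by simp
qed (auto intro: eqv_sym eqv_trans)

text \<open>Membership in \<open>lists A\<close> is carried through the induction, because
  \<open>rstep\<close> allows arbitrary contexts while \<open>same_element.refl\<close> asks for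
  words over \<open>A\<close>.\<close>

lemma eqv_same_element:
  assumes "R \<subseteq> lists A \<times> lists A" "u \<in> lists A" "u \<approx> v"
  shows "same_element A R u v \<and> v \<in> lists A"
  using assms(3)
proof induction
  case base
  then show ?case using same_element.refl[OF assms(2)] assms(2) by blast
next
  case (step y z)
  then obtain a b r s where h: "complement r s" "y = a @ r @ b" "z = a @ s @ b" unfolding rstep_def by blast
  have W: "w \<in> lists A" if "w \<in> W" for w using that assms(1) by (auto simp: relation_words_def)
  have ab: "a \<in> lists A" "b \<in> lists A" using step.IH h by auto
  have "(r, s) \<in> (R \<union> R\<inverse>)\<^sup>*" using h by (simp add: complement_def)
  then have "same_element A R r s"
  proof induction
    case base
    show ?case by (intro same_element.refl W complement_W(1)[OF h(1)])
  next
    case (step s s')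
    then have "same_element A R s s'" by (auto intro: same_element.rel same_element.sym)
    with step.IH show ?case by (rule same_element.trans)
  qed
  then have "same_element A R y z"
    unfolding h by (intro same_element.mult same_element.refl ab)
  moreover have "z \<in> lists A" using h ab W[OF complement_W(2)[OF h(1)]] by auto
  ultimately show ?case using same_element.trans[of A R u y z] step.IH by simp
qed

lemma reader_solves:
  assumes "R \<subseteq> lists A \<times> lists A" "u \<in> lists A"
  shows "\<exists>n \<le> (max_length + 2) * (length u + length v + 1).
    (read_step reader ^^ n) (Inl (([], [], [], [], []), u, v)) = Inr (same_element A R u v)"
proof -
  have "agree u v [] \<longleftrightarrow> same_element A R u v"
    using same_element_eqv eqv_same_element[OF assms] unfolding agree_def by auto
  then obtain n where "n \<le> (max_length + 2) * (length u + length v) + 1"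
    "(read_step reader ^^ n) (Inl (([], [], [], [], []), u, v)) = Inr (same_element A R u v)"
    using reader_decides[of "[]" "[]" "[]" "[]" "[]" u v] by (auto simp: weight_def)
  then show ?thesis by (intro exI[of _ n]) simp
qed

end

theorem theorem1:
  fixes A :: "'a set" and R :: "('a list \<times> 'a list) set"
  assumes "finite_presentation A R"
    and "weakly_C 4 R"
  shows "\<exists>M :: (nat, 'a tape_symbol) tm2.
           wf_tm2 (input_symbols A) M \<and> solves_word_problem_in_linear_time M A R"
proof -
  have A: "finite A" "finite R" "R \<subseteq> lists A \<times> lists A" using assms(1) by (auto simp: finite_presentation_def)
  interpret weakly_C4 R using A(2) assms(2) by unfold_locales
  show ?thesis
  proof (rule reader_machine[where k = "max_length + 2" and \<delta> = reader and Q = "controls A"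
        and ?c0.0 = "([], [], [], [], [])"])
    show "([], [], [], [], []) \<in> controls A" by (simp add: controls_def)
  qed (rule A(1) finite_controls[OF A(1)] controls_closed reader_solves[OF A(3)]; assumption)+
qed

end
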